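(* Let $k$ and $n$ be positive integers with $k+1\le n$. Then, in the group algebra $\mathbb{C}[S_k]$, the convolution identity $$\mathrm{Wg}_{k,n}=\mathrm{as}_{k,n}*\mathrm{Wg}_{k,n-1}$$ holds, where $\mathrm{Wg}_{k,n}$ and $\mathrm{Wg}_{k,n-1}$ are the unitary Weingarten functions and $\mathrm{as}_{k,n}$ is the ascension function.
   Context: $\mathbb{C}[S_k]$ is the space of complex-valued functions on the symmetric group $S_k$, with convolution $(f_1*f_2)(\pi)=\sum_{\sigma\in S_k}f_1(\sigma)f_2(\sigma^{-1}\pi)$. Rising factorial: $a^{\uparrow k}=\prod_{j=0}^{k-1}(a+j)$ for $k\ge1$, and $a^{\uparrow 0}=1$. Weingarten function: for $k\le n$ and $\pi\in S_k$, $$\mathrm{Wg}_{k,n}(\pi)=\mathbb{E}\bigl[u_{11}u_{22}\cdots u_{kk}\,\overline{u_{1\pi(1)}u_{2\pi(2)}\cdots u_{k\pi(k)}}\bigr],$$ where $U=(u_{ij})$ is a Haar-distributed matrix in the unitary group $\mathrm{U}(n)$. (It is a class function on $S_k$; equivalently, it is the convolution inverse in $\mathbb{C}[S_k]$ of the function $\pi\mapsto n^{\kappa(\pi)}$, where $\kappa(\pi)$ is the number of cycles of $\pi$, including fixed points.) Ascension function: for positive integers $k,n$ and $\sigma\in S_k$, $$\mathrm{as}_{k,n}(\sigma)=\sum_{t=0}^{\mathsf{f}(\sigma)}(-1)^{k-t}\binom{\mathsf{f}(\sigma)}{t}\frac{1}{n^{\uparrow(k-t)}},$$ where $\mathsf{f}(\sigma)=|\{i\in\{1,\dots,k\}:\sigma(i)=i\}|$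 is the number of fixed points of $\sigma$. *)

theory Defs
  imports "HOL-Probability.Probability" "Jordan_Normal_Form.Schur_Decomposition"
begin

text \<open>Indices are shifted by one to match matrix indexing: the symmetric group on \<open>k\<close> points is
  realised as the permutations of \<open>{..<k}\<close>, and the entry \<open>u\<^sub>1\<^sub>1\<close> is \<open>U $$ (0,0)\<close>.
  An element of the group algebra is a function on \<open>nat \<Rightarrow> nat\<close> of which only the values at
  these permutations matter.\<close>

definition sym_group :: "nat \<Rightarrow> (nat \<Rightarrow> nat) set" where
  "sym_group k = {\<pi>. \<pi> permutes {..<k}}"

definition group_convolution ::
    "nat \<Rightarrow> ((nat \<Rightarrow> nat) \<Rightarrow> complex) \<Rightarrow> ((nat \<Rightarrow> nat) \<Rightarrow> complex) \<Rightarrow> (nat \<Rightarrow> nat) \<Rightarrow> complex" where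
  "group_convolution k f g \<pi> = (\<Sum>\<sigma>\<in>sym_group k. f \<sigma> * g (inv_into UNIV \<sigma> \<circ> \<pi>))"

definition unitary_group :: "nat \<Rightarrow> complex mat set" where
  "unitary_group n =
     {U \<in> carrier_mat n n. U * mat_adjoint U = 1\<^sub>m n \<and> mat_adjoint U * U = 1\<^sub>m n}"

text \<open>The type of matrices carries no topology. The Borel sigma-algebra of the unitary group, as a
  subspace of the \<open>n * n\<close>-fold power of the complex plane, is obtained by pulling back the
  product Borel sigma-algebra along the map that lists the entries.\<close>

definition unitary_borel :: "nat \<Rightarrow> complex mat measure" where
  "unitary_borel n =
     vimage_algebra (unitary_group n)
       (\<lambda>U. \<lambda>(i, j)\<in>{..<n} \<times> {..<n}. U $$ (i, j))
       (\<Pi>\<^sub>M p\<in>{..<n} \<times> {..<n}. borel)"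

text \<open>The Haar measure is characterised as the left-invariant Borel probability measure; by
  compactness it exists, is unique, and is also right-invariant.\<close>

definition haar_unitary :: "nat \<Rightarrow> complex mat measure \<Rightarrow> bool" where
  "haar_unitary n \<mu> \<longleftrightarrow>
     prob_space \<mu> \<and> sets \<mu> = sets (unitary_borel n) \<and>
     (\<forall>V\<in>unitary_group n. distr \<mu> \<mu> (\<lambda>U. V * U) = \<mu>)"

text \<open>The expectation is taken under \<open>\<mu>\<close>, the law of the random unitary matrix, so the dimension
  \<open>n\<close> enters only through \<open>\<mu>\<close>. The definition is meaningful for \<open>k \<le> n\<close>.\<close>

definition weingarten :: "nat \<Rightarrow> complex mat measure \<Rightarrow> (nat \<Rightarrow> nat) \<Rightarrow> complex" where
  "weingarten k \<mu> \<pi> =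
     (\<integral>U. (\<Prod>i<k. U $$ (i, i)) * cnj (\<Prod>i<k. U $$ (i, \<pi> i)) \<partial>\<mu>)"

definition fixed_points :: "nat \<Rightarrow> (nat \<Rightarrow> nat) \<Rightarrow> nat" where
  "fixed_points k \<sigma> = card {i \<in> {..<k}. \<sigma> i = i}"

definition ascension :: "nat \<Rightarrow> nat \<Rightarrow> (nat \<Rightarrow> nat) \<Rightarrow> complex" where
  "ascension k n \<sigma> =
     (\<Sum>t = 0..fixed_points k \<sigma>.
        (-1) ^ (k - t) * of_nat (fixed_points k \<sigma> choose t) / pochhammer (of_nat n) (k - t))"

end

theory Submission
  imports Defs
begin

text \<open>
  Let \<open>U\<close> be Haar-distributed of size \<open>n = m + 1\<close>, and let \<open>V\<close> be an independent
  Haar-distributed matrix of size \<open>m\<close>. By left invariance \<open>U\<close> has the same law as the product of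
  the block diagonal matrix with blocks \<open>V\<close> and \<open>1\<close> with \<open>U\<close> itself. Substituting this in the
  Weingarten integral of size \<open>n\<close> and expanding gives a sum of products of a moment of \<open>V\<close> and a moment
  of \<open>U\<close> (\<open>moment_restrict\<close>). Each moment of \<open>V\<close> that occurs is, after passing to the
  adjoint, a sum of Weingarten functions of size \<open>m\<close> over the permutations that match the two families of
  indices (\<open>moment_distinct_columns\<close>). For every such permutation the remaining sum over indices
  below \<open>m\<close> builds, by the orthogonality of the columns of \<open>U\<close>, the mean of a product of entries
  \<open>\<delta> - v\<^sub>i v\<^sub>j\<^sup>*\<close>, where \<open>v\<close> is the last row of \<open>U\<close>
  (\<open>moment_row_sum\<close>). Expanding that product and using that the mean of
  \<open>\<bar>v\<^sub>1 \<cdots> v\<^sub>r\<bar>\<^sup>2\<close> is the reciprocal of the rising factorial of \<open>n\<close> of length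
  \<open>r\<close> (\<open>moment_column\<close>), one finds exactly the ascension function
  (\<open>projection_moment\<close>).

  Everything about moments follows from left invariance alone. Diagonal unitary matrices make moments with
  unbalanced rows vanish (\<open>moment_eq_0\<close>), and plane rotations, compared to first order in the squared
  tangent of the angle, express a moment with a repeated row by moments with that row split
  (\<open>moment_split_row\<close>). This relation takes the place of Schur-Weyl duality: it determines both the moments with
  distinct columns and those of a single column. Invariance under the adjoint (\<open>moment_adjoint\<close>) exchanges
  the roles of rows and columns.
\<close>

section \<open>Unitary matrices in coordinates\<close>

lemma mat_adjoint_entry:
  assumes "A \<in> carrier_mat n n" "i < n" "j < n"
  shows "mat_adjoint A $$ (i, j) = cnj (A $$ (j, i :: nat))"
  using assms unfolding mat_adjoint_def by (auto simp: mat_of_rows_def)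

lemma mat_adjoint_carrier [intro]:
  fixes A :: "complex mat"
  assumes "A \<in> carrier_mat n n"
  shows "mat_adjoint A \<in> carrier_mat n n"
  using assms unfolding mat_adjoint_def by (auto simp: mat_of_rows_def)

lemma mult_entry:
  fixes A B :: "complex mat"
  assumes "A \<in> carrier_mat n n" "B \<in> carrier_mat n n" "i < n" "j < n"
  shows "(A * B) $$ (i, j) = (\<Sum>l<n. A $$ (i, l) * B $$ (l, j))"
  using assms by (auto simp: scalar_prod_def atLeast0LessThan)

lemma mat_adjoint_adjoint:
  fixes A :: "complex mat"
  assumes "A \<in> carrier_mat n n"
  shows "mat_adjoint (mat_adjoint A) = A"
  using assms mat_adjoint_carrier[OF assms] mat_adjoint_carrier[OF mat_adjoint_carrier[OF assms]]
  by (intro eq_matI) (auto simp: mat_adjoint_entry[where n = n])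

lemma mat_adjoint_mult:
  fixes A B :: "complex mat"
  assumes "A \<in> carrier_mat n n" "B \<in> carrier_mat n n"
  shows "mat_adjoint (A * B) = mat_adjoint B * mat_adjoint A"
proof (rule eq_matI)
  have AB: "A * B \<in> carrier_mat n n" using assms by auto
  note c = mat_adjoint_carrier[OF assms(1)] mat_adjoint_carrier[OF assms(2)] mat_adjoint_carrier[OF AB]
  show "dim_row (mat_adjoint (A * B)) = dim_row (mat_adjoint B * mat_adjoint A)"
    "dim_col (mat_adjoint (A * B)) = dim_col (mat_adjoint B * mat_adjoint A)"
    using c by auto
  fix i j assume "i < dim_row (mat_adjoint B * mat_adjoint A)"
    "j < dim_col (mat_adjoint B * mat_adjoint A)"
  then have ij: "i < n" "j < n" using c by auto
  then show "mat_adjoint (A * B) $$ (i, j) = (mat_adjoint B * mat_adjoint A) $$ (i, j)"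
    using assms AB c
    by (simp add: mat_adjoint_entry[where n = n] mult_entry[where n = n] mult.commute
        del: index_mult_mat)
qed

lemma unitary_groupI:
  assumes "U \<in> carrier_mat n n"
    and "\<And>i j. i < n \<Longrightarrow> j < n \<Longrightarrow>
      (\<Sum>l<n. U $$ (i, l) * cnj (U $$ (j, l))) = (if i = j then 1 else 0)"
  shows "U \<in> unitary_group n"
proof -
  note c = mat_adjoint_carrier[OF assms(1)]
  have "U * mat_adjoint U = 1\<^sub>m n"
  proof (rule eq_matI)
    fix i j assume "i < dim_row (1\<^sub>m n :: complex mat)" "j < dim_col (1\<^sub>m n :: complex mat)"
    then show "(U * mat_adjoint U) $$ (i, j) = 1\<^sub>m n $$ (i, j)"
      using assms c by (simp add: mat_adjoint_entry[where n = n] mult_entry[where n = n]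
        del: index_mult_mat)
  qed (use assms c in auto)
  then show ?thesis
    using mat_mult_left_right_inverse[OF assms(1) c] assms(1) by (simp add: unitary_group_def)
qed

lemma unitary_carrier: "U \<in> unitary_group n \<Longrightarrow> U \<in> carrier_mat n n"
  by (simp add: unitary_group_def)

lemma unitary_adjoint: "U \<in> unitary_group n \<Longrightarrow> mat_adjoint U \<in> unitary_group n"
  by (auto simp: unitary_group_def mat_adjoint_adjoint)

lemma unitary_mult:
  assumes "U \<in> unitary_group n" "V \<in> unitary_group n"
  shows "U * V \<in> unitary_group n"
proof -
  note c = unitary_carrier[OF assms(1)] unitary_carrier[OF assms(2)]
  note d = mat_adjoint_carrier[OF c(1)] mat_adjoint_carrier[OF c(2)]
  have "(U * V) * mat_adjoint (U * V) = U * (V * mat_adjoint V) * mat_adjoint U"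
    using c d by (simp add: mat_adjoint_mult[OF c] assoc_mult_mat[where n\<^sub>1 = n and n\<^sub>2 = n and n\<^sub>3 = n and n\<^sub>4 = n])
  then have "(U * V) * mat_adjoint (U * V) = 1\<^sub>m n"
    using assms c d by (simp add: unitary_group_def)
  then show ?thesis
    using mat_mult_left_right_inverse[of "U * V" n "mat_adjoint (U * V)"] c
      mat_adjoint_carrier[of "U * V" n]
    by (auto simp: unitary_group_def)
qed

lemma unitary_rows:
  assumes "U \<in> unitary_group n" "i < n" "j < n"
  shows "(\<Sum>l<n. U $$ (i, l) * cnj (U $$ (j, l))) = (if i = j then 1 else 0)"
proof -
  note c = unitary_carrier[OF assms(1)] mat_adjoint_carrier[OF unitary_carrier[OF assms(1)]]
  have "(U * mat_adjoint U) $$ (i, j) = (if i = j then 1 else 0)"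
    using assms by (simp add: unitary_group_def)
  then show ?thesis
    using assms c
    by (simp add: mat_adjoint_entry[where n = n] mult_entry[where n = n] del: index_mult_mat)
qed

lemma unitary_columns:
  assumes "U \<in> unitary_group n" "i < n" "j < n"
  shows "(\<Sum>l<n. U $$ (l, i) * cnj (U $$ (l, j))) = (if i = j then 1 else 0)"
  using unitary_rows[OF unitary_adjoint[OF assms(1)] assms(3,2)] assms(2,3)
    unitary_carrier[OF assms(1)]
  by (auto simp: mat_adjoint_entry[where n = n] mult.commute)

lemma unitary_entry_le_1:
  assumes "U \<in> unitary_group n" "i < n" "j < n"
  shows "norm (U $$ (i, j)) \<le> 1"
proof -
  have "of_real (\<Sum>l<n. (norm (U $$ (i, l)))\<^sup>2) = (1 :: complex)"
    using unitary_rows[OF assms(1,2,2)] by (simp add: complex_norm_square[symmetric])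
  then have *: "(\<Sum>l<n. (norm (U $$ (i, l)))\<^sup>2) = 1"
    using of_real_eq_1_iff by blast
  have "(norm (U $$ (i, j)))\<^sup>2 \<le> (\<Sum>l<n. (norm (U $$ (i, l)))\<^sup>2)"
    using assms by (intro member_le_sum) auto
  then show ?thesis using * by (simp add: power_le_one_iff abs_square_le_1)
qed

section \<open>Monomials in the entries and their Haar moments\<close>

text \<open>The first two index functions belong to the unconjugated entries, the last two to the conjugated
  ones. Rows precede columns in either pair, so in \<open>monomial I a c b d\<close> the rows are \<open>a\<close> and \<open>b\<close>.
  An arbitrary index set \<open>I\<close> makes it possible to let one entry occur several times.\<close>

definition monomial ::
    "'i set \<Rightarrow> ('i \<Rightarrow> nat) \<Rightarrow> ('i \<Rightarrow> nat) \<Rightarrow> ('i \<Rightarrow> nat) \<Rightarrow> ('i \<Rightarrow> nat) \<Rightarrow> complex mat \<Rightarrow> complex" where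
  "monomial I a c b d U = (\<Prod>i\<in>I. U $$ (a i, c i)) * cnj (\<Prod>i\<in>I. U $$ (b i, d i))"

definition moment ::
    "complex mat measure \<Rightarrow> 'i set \<Rightarrow> ('i \<Rightarrow> nat) \<Rightarrow> ('i \<Rightarrow> nat) \<Rightarrow> ('i \<Rightarrow> nat) \<Rightarrow> ('i \<Rightarrow> nat) \<Rightarrow> complex" where
  "moment \<mu> I a c b d = (\<integral>U. monomial I a c b d U \<partial>\<mu>)"

lemma monomial_cong:
  assumes "\<And>i. i \<in> I \<Longrightarrow> a i = a' i" "\<And>i. i \<in> I \<Longrightarrow> c i = c' i"
    "\<And>i. i \<in> I \<Longrightarrow> b i = b' i" "\<And>i. i \<in> I \<Longrightarrow> d i = d' i"
  shows "monomial I a c b d = monomial I a' c' b' d'"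
  using assms by (auto simp: monomial_def fun_eq_iff)

lemma moment_cong:
  assumes "\<And>i. i \<in> I \<Longrightarrow> a i = a' i" "\<And>i. i \<in> I \<Longrightarrow> c i = c' i"
    "\<And>i. i \<in> I \<Longrightarrow> b i = b' i" "\<And>i. i \<in> I \<Longrightarrow> d i = d' i"
  shows "moment \<mu> I a c b d = moment \<mu> I a' c' b' d'"
  using monomial_cong[of I a a' c c' b b' d d', OF assms] by (simp add: moment_def)

text \<open>A product of sums over the row index is a sum over index functions. With \<open>B\<close> fixed and \<open>U\<close>
  Haar-distributed this turns left invariance into a finite linear relation between moments, which is
  why no product measure and no Fubini argument is needed below.\<close>

lemma monomial_mult:
  assumes B: "B \<in> carrier_mat n n" and U: "U \<in> carrier_mat n n" and I: "finite I"
    and abcd: "a \<in> I \<rightarrow> {..<n}" "c \<in> I \<rightarrow> {..<n}" "b \<in> I \<rightarrow> {..<n}" "d \<in> I \<rightarrow> {..<n}"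
  shows "monomial I a c b d (B * U) =
    (\<Sum>l\<in>I \<rightarrow>\<^sub>E {..<n}. \<Sum>l'\<in>I \<rightarrow>\<^sub>E {..<n}. monomial I a l b l' B * monomial I l c l' d U)"
proof -
  have *: "(\<Prod>i\<in>I. (B * U) $$ (a i, c i)) =
      (\<Sum>l\<in>I \<rightarrow>\<^sub>E {..<n}. (\<Prod>i\<in>I. B $$ (a i, l i)) * (\<Prod>i\<in>I. U $$ (l i, c i)))"
    if "a \<in> I \<rightarrow> {..<n}" "c \<in> I \<rightarrow> {..<n}" for a c
  proof -
    have "(\<Prod>i\<in>I. (B * U) $$ (a i, c i)) =
        (\<Prod>i\<in>I. \<Sum>l<n. B $$ (a i, l) * U $$ (l, c i))"
      using that by (intro prod.cong refl mult_entry[OF B U]) auto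
    also have "\<dots> = (\<Sum>l\<in>I \<rightarrow>\<^sub>E {..<n}. \<Prod>i\<in>I. B $$ (a i, l i) * U $$ (l i, c i))"
      using I by (subst prod_sum_PiE) auto
    finally show ?thesis by (simp add: prod.distrib)
  qed
  show ?thesis
    unfolding monomial_def *[OF abcd(1,2)] *[OF abcd(3,4)]
    by (simp add: sum_product cnj_sum mult.assoc mult.left_commute)
qed

lemma monomial_adjoint:
  assumes U: "U \<in> carrier_mat n n"
    and abcd: "a \<in> I \<rightarrow> {..<n}" "c \<in> I \<rightarrow> {..<n}" "b \<in> I \<rightarrow> {..<n}" "d \<in> I \<rightarrow> {..<n}"
  shows "monomial I a c b d (mat_adjoint U) = monomial I d b c a U"
proof -
  have "(\<Prod>i\<in>I. mat_adjoint U $$ (a i, c i)) = cnj (\<Prod>i\<in>I. U $$ (c i, a i))"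
    if "a \<in> I \<rightarrow> {..<n}" "c \<in> I \<rightarrow> {..<n}" for a c
    unfolding cnj_prod using that by (intro prod.cong refl mat_adjoint_entry[OF U]) auto
  from this[OF abcd(1,2)] this[OF abcd(3,4)] show ?thesis
    by (simp add: monomial_def mult.commute)
qed

locale haar_law =
  fixes n :: nat and \<mu> :: "complex mat measure"
  assumes haar: "haar_unitary n \<mu>"
begin

lemma prob: "prob_space \<mu>"
  using haar by (simp add: haar_unitary_def)

sublocale prob_space \<mu> by (rule prob)

lemma sets_eq: "sets \<mu> = sets (unitary_borel n)"
  using haar by (simp add: haar_unitary_def)

lemma space_eq: "space \<mu> = unitary_group n"
  using sets_eq_imp_space_eq[OF sets_eq] by (simp add: unitary_borel_def)

lemma entry_measurable:
  assumes "i < n" "j < n"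
  shows "(\<lambda>U. U $$ (i, j)) \<in> borel_measurable \<mu>"
proof -
  let ?e = "\<lambda>U :: complex mat. \<lambda>(i, j)\<in>{..<n} \<times> {..<n}. U $$ (i, j)"
  let ?P = "\<Pi>\<^sub>M p\<in>{..<n} \<times> {..<n}. (borel :: complex measure)"
  have "?e \<in> measurable (unitary_borel n) ?P"
    unfolding unitary_borel_def
    by (rule measurable_vimage_algebra1) (auto simp: space_PiM)
  then have "(\<lambda>U. ?e U (i, j)) \<in> borel_measurable (unitary_borel n)"
    by (rule measurable_compose[OF _ measurable_component_singleton]) (use assms in auto)
  also have "(\<lambda>U. ?e U (i, j)) = (\<lambda>U. U $$ (i, j))"
    using assms by (auto simp: fun_eq_iff)
  finally show ?thesis
    using measurable_cong_sets[OF sets_eq refl] by blast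
qed

lemma monomial_measurable:
  assumes "a \<in> I \<rightarrow> {..<n}" "c \<in> I \<rightarrow> {..<n}" "b \<in> I \<rightarrow> {..<n}" "d \<in> I \<rightarrow> {..<n}"
  shows "monomial I a c b d \<in> borel_measurable \<mu>"
proof -
  have "(\<lambda>U. \<Prod>i\<in>I. U $$ (a i, c i)) \<in> borel_measurable \<mu>"
    if "a \<in> I \<rightarrow> {..<n}" "c \<in> I \<rightarrow> {..<n}" for a c
    using that by (intro borel_measurable_prod entry_measurable) auto
  from this[OF assms(1,2)] this[OF assms(3,4)] show ?thesis
    unfolding monomial_def [abs_def]
    by (intro borel_measurable_times measurable_compose[OF _ borel_measurable_continuous_onI[of cnj]])
       (auto intro: continuous_intros)
qed

lemma monomial_integrable:
  assumes "a \<in> I \<rightarrow> {..<n}" "c \<in> I \<rightarrow> {..<n}" "b \<in> I \<rightarrow> {..<n}" "d \<in> I \<rightarrow> {..<n}"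
  shows "integrable \<mu> (monomial I a c b d)"
proof (rule integrable_const_bound)
  show "AE U in \<mu>. norm (monomial I a c b d U) \<le> 1"
  proof (rule AE_I2)
    fix U assume "U \<in> space \<mu>"
    then have U: "U \<in> unitary_group n" by (simp add: space_eq)
    have *: "norm (\<Prod>i\<in>I. U $$ (a i, c i)) \<le> 1" if "a \<in> I \<rightarrow> {..<n}" "c \<in> I \<rightarrow> {..<n}" for a c
      unfolding prod_norm[symmetric] using that
      by (intro prod_le_1) (auto intro!: unitary_entry_le_1[OF U])
    show "norm (monomial I a c b d U) \<le> 1"
      using mult_mono[OF *[OF assms(1,2)] *[OF assms(3,4)]]
      by (simp add: monomial_def norm_mult del: cnj_prod)
  qed
qed (rule monomial_measurable[OF assms])

lemma mult_measurable:
  assumes B: "B \<in> unitary_group n"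
  shows "(\<lambda>U. B * U) \<in> measurable \<mu> \<mu>"
proof -
  let ?e = "\<lambda>U :: complex mat. \<lambda>(i, j)\<in>{..<n} \<times> {..<n}. U $$ (i, j)"
  let ?P = "\<Pi>\<^sub>M p\<in>{..<n} \<times> {..<n}. (borel :: complex measure)"
  have "(\<lambda>U. B * U) \<in> measurable \<mu> (unitary_borel n)"
    unfolding unitary_borel_def
  proof (rule measurable_vimage_algebra2)
    show "(\<lambda>U. B * U) \<in> space \<mu> \<rightarrow> unitary_group n"
      by (auto simp: space_eq unitary_mult[OF B])
    have "(\<lambda>U. (B * U) $$ (i, j)) \<in> borel_measurable \<mu>" if "i < n" "j < n" for i j
    proof -
      have "(\<lambda>U. \<Sum>l<n. B $$ (i, l) * U $$ (l, j)) \<in> borel_measurable \<mu>"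
        using that by (intro borel_measurable_sum borel_measurable_times entry_measurable) auto
      moreover have "(B * U) $$ (i, j) = (\<Sum>l<n. B $$ (i, l) * U $$ (l, j))" if "U \<in> space \<mu>" for U
        using that \<open>i < n\<close> \<open>j < n\<close> B
        by (intro mult_entry unitary_carrier) (auto simp: space_eq)
      ultimately show ?thesis by (simp cong: measurable_cong)
    qed
    then show "(\<lambda>U. ?e (B * U)) \<in> measurable \<mu> ?P"
      by (intro measurable_restrict) (auto split: prod.splits)
  qed
  then show ?thesis
    using measurable_cong_sets[OF refl sets_eq] by blast
qed

lemma left_invariant:
  assumes B: "B \<in> unitary_group n"
    and abcd: "a \<in> I \<rightarrow> {..<n}" "c \<in> I \<rightarrow> {..<n}" "b \<in> I \<rightarrow> {..<n}" "d \<in> I \<rightarrow> {..<n}"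
  shows "(\<integral>U. monomial I a c b d (B * U) \<partial>\<mu>) = moment \<mu> I a c b d"
proof -
  have "distr \<mu> \<mu> (\<lambda>U. B * U) = \<mu>"
    using haar B by (simp add: haar_unitary_def)
  then have "moment \<mu> I a c b d = (\<integral>U. monomial I a c b d U \<partial>distr \<mu> \<mu> (\<lambda>U. B * U))"
    by (simp add: moment_def)
  also have "\<dots> = (\<integral>U. monomial I a c b d (B * U) \<partial>\<mu>)"
    by (rule integral_distr[OF mult_measurable[OF B] monomial_measurable[OF abcd]])
  finally show ?thesis ..
qed

lemma moment_expand:
  assumes B: "B \<in> unitary_group n" and I: "finite I"
    and abcd: "a \<in> I \<rightarrow> {..<n}" "c \<in> I \<rightarrow> {..<n}" "b \<in> I \<rightarrow> {..<n}" "d \<in> I \<rightarrow> {..<n}"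
  shows "moment \<mu> I a c b d =
    (\<Sum>l\<in>I \<rightarrow>\<^sub>E {..<n}. \<Sum>l'\<in>I \<rightarrow>\<^sub>E {..<n}. monomial I a l b l' B * moment \<mu> I l c l' d)"
proof -
  have int: "integrable \<mu> (monomial I l c l' d)"
    if "l \<in> I \<rightarrow>\<^sub>E {..<n}" "l' \<in> I \<rightarrow>\<^sub>E {..<n}" for l l'
    using that abcd by (intro monomial_integrable) (auto simp: PiE_def)
  have "moment \<mu> I a c b d = (\<integral>U. (\<Sum>l\<in>I \<rightarrow>\<^sub>E {..<n}. \<Sum>l'\<in>I \<rightarrow>\<^sub>E {..<n}.
      monomial I a l b l' B * monomial I l c l' d U) \<partial>\<mu>)"
    unfolding left_invariant[OF B abcd, symmetric]
    by (intro Bochner_Integration.integral_cong refl monomial_mult[OF _ _ I abcd] unitary_carrier)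
       (use B in \<open>auto simp: space_eq\<close>)
  also have "\<dots> = (\<Sum>l\<in>I \<rightarrow>\<^sub>E {..<n}. \<Sum>l'\<in>I \<rightarrow>\<^sub>E {..<n}. monomial I a l b l' B * moment \<mu> I l c l' d)"
    using int by (simp add: moment_def)
  finally show ?thesis .
qed

text \<open>Let \<open>f\<close> be the monomial. Average \<open>f (W\<^sup>* U)\<close> over independent \<open>U\<close> and \<open>W\<close>: by left invariance
  in \<open>U\<close> the result is the mean of \<open>f\<close>. The average of \<open>f\<^sup>* (W\<^sup>* U)\<close>, where
  \<open>f\<^sup>* (X) = f (X\<^sup>*)\<close>, is the same bilinear expression with \<open>U\<close> and \<open>W\<close>
  exchanged. The lemma replaces right invariance: it lets every statement about rows be read for columns.\<close>

lemma moment_adjoint: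
  assumes I: "finite I"
    and abcd: "a \<in> I \<rightarrow> {..<n}" "c \<in> I \<rightarrow> {..<n}" "b \<in> I \<rightarrow> {..<n}" "d \<in> I \<rightarrow> {..<n}"
  shows "moment \<mu> I a c b d = moment \<mu> I d b c a"
proof -
  let ?L = "I \<rightarrow>\<^sub>E {..<n}"
  have *: "moment \<mu> I a c b d =
      (\<Sum>l\<in>?L. \<Sum>l'\<in>?L. moment \<mu> I l' b l a * moment \<mu> I l c l' d)"
    if abcd: "a \<in> I \<rightarrow> {..<n}" "c \<in> I \<rightarrow> {..<n}" "b \<in> I \<rightarrow> {..<n}" "d \<in> I \<rightarrow> {..<n}"
    for a b c d
  proof -
    have int: "integrable \<mu> (monomial I l' b l a)" if "l \<in> ?L" "l' \<in> ?L" for l l'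
      using that abcd by (intro monomial_integrable) (auto simp: PiE_def)
    have "moment \<mu> I a c b d =
        (\<Sum>l\<in>?L. \<Sum>l'\<in>?L. monomial I l' b l a U * moment \<mu> I l c l' d)"
      if "U \<in> space \<mu>" for U
    proof -
      have U: "U \<in> unitary_group n" using that by (simp add: space_eq)
      have "monomial I a l b l' (mat_adjoint U) = monomial I l' b l a U"
        if "l \<in> ?L" "l' \<in> ?L" for l l'
        using that abcd by (intro monomial_adjoint[OF unitary_carrier[OF U]]) (auto simp: PiE_def)
      then show ?thesis
        by (subst moment_expand[OF unitary_adjoint[OF U] I abcd]) simp
    qed
    then have "(\<integral>U. moment \<mu> I a c b d \<partial>\<mu>) =
        (\<integral>U. (\<Sum>l\<in>?L. \<Sum>l'\<in>?L. monomial I l' b l a U * moment \<mu> I l c l' d) \<partial>\<mu>)"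
      by (intro Bochner_Integration.integral_cong refl) auto
    also have "\<dots> = (\<Sum>l\<in>?L. \<Sum>l'\<in>?L. moment \<mu> I l' b l a * moment \<mu> I l c l' d)"
      using int by (simp add: moment_def[symmetric])
    finally show ?thesis by (simp add: prob_space)
  qed
  show ?thesis
    unfolding *[OF abcd] *[OF abcd(4,3,2,1)]
    by (subst sum.swap) (simp add: mult.commute)
qed

end

section \<open>Relations between moments from permutations, phases and rotations of rows\<close>

lemma sum_Pow_card_1:
  assumes "finite A"
  shows "(\<Sum>S\<in>Pow A. if card S = 1 then g S else 0) = (\<Sum>i\<in>A. g {i} :: 'b :: comm_monoid_add)"
proof -
  have "(\<Sum>S\<in>Pow A. if card S = 1 then g S else 0) = (\<Sum>S\<in>{S \<in> Pow A. card S = 1}. g S)"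
    using assms by (subst sum.inter_filter) auto
  also have "{S \<in> Pow A. card S = 1} = (\<lambda>i. {i}) ` A"
    by (auto simp: card_1_singleton_iff)
  also have "(\<Sum>S\<in>(\<lambda>i. {i}) ` A. g S) = (\<Sum>i\<in>A. g {i})"
    by (subst sum.reindex) (auto simp: inj_on_def)
  finally show ?thesis .
qed

definition permutation_mat :: "nat \<Rightarrow> (nat \<Rightarrow> nat) \<Rightarrow> complex mat" where
  "permutation_mat n \<rho> = mat n n (\<lambda>(i, j). if j = \<rho> i then 1 else 0)"

lemma permutation_mat_row:
  assumes "\<rho> permutes {..<n}" "i < n"
  shows "(\<Sum>l<n. permutation_mat n \<rho> $$ (i, l) * f l) = f (\<rho> i)"
proof -
  have "\<rho> i < n" using permutes_in_image[OF assms(1), of i] assms(2) by simp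
  have "(\<Sum>l<n. permutation_mat n \<rho> $$ (i, l) * f l) = (\<Sum>l<n. if l = \<rho> i then f l else 0)"
    using assms(2) by (intro sum.cong) (auto simp: permutation_mat_def)
  then show ?thesis using \<open>\<rho> i < n\<close> by simp
qed

lemma permutation_mat_unitary:
  assumes "\<rho> permutes {..<n}"
  shows "permutation_mat n \<rho> \<in> unitary_group n"
proof (rule unitary_groupI)
  show "permutation_mat n \<rho> \<in> carrier_mat n n" by (simp add: permutation_mat_def)
  fix i j assume ij: "i < n" "j < n"
  have "\<rho> i < n" using permutes_in_image[OF assms(1), of i] ij by simp
  then show "(\<Sum>l<n. permutation_mat n \<rho> $$ (i, l) * cnj (permutation_mat n \<rho> $$ (j, l))) =
      (if i = j then 1 else 0)"
    using permutes_inj[OF assms] ij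
    by (subst permutation_mat_row[OF assms])
       (auto simp: permutation_mat_def inj_eq)
qed

definition phase_mat :: "nat \<Rightarrow> nat \<Rightarrow> complex \<Rightarrow> complex mat" where
  "phase_mat n q z = mat n n (\<lambda>(i, j). if i = j then if i = q then z else 1 else 0)"

lemma phase_mat_row:
  assumes "i < n"
  shows "(\<Sum>l<n. phase_mat n q z $$ (i, l) * f l) = (if i = q then z else 1) * f i"
proof -
  have "(\<Sum>l<n. phase_mat n q z $$ (i, l) * f l) =
      (\<Sum>l<n. if l = i then (if i = q then z else 1) * f i else 0)"
    using assms by (intro sum.cong) (auto simp: phase_mat_def)
  then show ?thesis using assms by simp
qed

lemma phase_mat_unitary:
  assumes "z * cnj z = 1"
  shows "phase_mat n q z \<in> unitary_group n"
proof (rule unitary_groupI)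
  show "phase_mat n q z \<in> carrier_mat n n" by (simp add: phase_mat_def)
  fix i j assume ij: "i < n" "j < n"
  then show "(\<Sum>l<n. phase_mat n q z $$ (i, l) * cnj (phase_mat n q z $$ (j, l))) =
      (if i = j then 1 else 0)"
    using assms by (subst phase_mat_row) (auto simp: phase_mat_def)
qed

text \<open>A rotation by an angle with cosine \<open>u\<close> and sine \<open>v\<close> in the plane of the coordinates \<open>p\<close>
  and \<open>q\<close>.\<close>

definition rotation_mat :: "nat \<Rightarrow> nat \<Rightarrow> nat \<Rightarrow> real \<Rightarrow> real \<Rightarrow> complex mat" where
  "rotation_mat n p q u v = mat n n (\<lambda>(i, j).
     if i = q then if j = q then of_real u else if j = p then of_real v else 0
     else if i = p then if j = q then - of_real v else if j = p then of_real u else 0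
     else if i = j then 1 else 0)"

lemma rotation_mat_row:
  assumes "i < n" "p < n" "q < n" "p \<noteq> q"
  shows "(\<Sum>l<n. rotation_mat n p q u v $$ (i, l) * f l) =
    (if i = q then of_real u * f q + of_real v * f p
     else if i = p then of_real u * f p - of_real v * f q else f i)"
proof -
  have pick: "(\<Sum>l<n. (if l = x then s else if l = y then t else 0) * f l) = s * f x + t * f y"
    if "x < n" "y < n" "x \<noteq> y" for x y s t
  proof -
    have "(\<Sum>l<n. (if l = x then s else if l = y then t else 0) * f l) =
        (\<Sum>l<n. (if l = x then s * f x else 0) + (if l = y then t * f y else 0))"
      using that by (intro sum.cong) auto
    then show ?thesis using that by (simp add: sum.distrib)
  qed
  consider "i = q" | "i = p" "i \<noteq> q" | "i \<noteq> p" "i \<noteq> q" by blast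
  then show ?thesis
  proof cases
    case 1
    then show ?thesis using assms pick[of q p "of_real u" "of_real v"]
      by (simp add: rotation_mat_def)
  next
    case 2
    then show ?thesis using assms pick[of q p "- of_real v" "of_real u"]
      by (simp add: rotation_mat_def)
  next
    case 3
    then have "(\<Sum>l<n. rotation_mat n p q u v $$ (i, l) * f l) = (\<Sum>l<n. if l = i then f i else 0)"
      using assms by (intro sum.cong) (auto simp: rotation_mat_def)
    then show ?thesis using 3 assms by simp
  qed
qed

lemma rotation_mat_unitary:
  assumes "u\<^sup>2 + v\<^sup>2 = 1" "p < n" "q < n" "p \<noteq> q"
  shows "rotation_mat n p q u v \<in> unitary_group n"
proof (rule unitary_groupI)
  show "rotation_mat n p q u v \<in> carrier_mat n n" by (simp add: rotation_mat_def)
  fix i j assume ij: "i < n" "j < n"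
  have "complex_of_real u * of_real u + of_real v * of_real v = 1"
    using assms(1) by (metis of_real_1 of_real_add of_real_mult power2_eq_square)
  then show "(\<Sum>l<n. rotation_mat n p q u v $$ (i, l) * cnj (rotation_mat n p q u v $$ (j, l))) =
      (if i = j then 1 else 0)"
    using ij assms(2-)
    by (subst rotation_mat_row[OF ij(1) assms(2-)]) (auto simp: rotation_mat_def add.commute)
qed

context haar_law
begin

lemma moment_phase:
  assumes I: "finite I" and z: "z * cnj z = 1"
    and abcd: "a \<in> I \<rightarrow> {..<n}" "c \<in> I \<rightarrow> {..<n}" "b \<in> I \<rightarrow> {..<n}" "d \<in> I \<rightarrow> {..<n}"
  shows "moment \<mu> I a c b d =
    z ^ card {i \<in> I. a i = q} * cnj z ^ card {i \<in> I. b i = q} * moment \<mu> I a c b d"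
proof -
  have B: "phase_mat n q z \<in> unitary_group n" by (rule phase_mat_unitary[OF z])
  have *: "(\<Prod>i\<in>I. (phase_mat n q z * U) $$ (a i, c i)) =
      z ^ card {i \<in> I. a i = q} * (\<Prod>i\<in>I. U $$ (a i, c i))"
    if "U \<in> unitary_group n" "a \<in> I \<rightarrow> {..<n}" "c \<in> I \<rightarrow> {..<n}" for U a c
  proof -
    have "(phase_mat n q z * U) $$ (a i, c i) = (if a i = q then z else 1) * U $$ (a i, c i)"
      if "i \<in> I" for i
    proof -
      have i: "a i < n" "c i < n" using \<open>i \<in> I\<close> \<open>a \<in> _\<close> \<open>c \<in> _\<close> by auto
      then show ?thesis
        using mult_entry[OF unitary_carrier[OF B] unitary_carrier[OF \<open>U \<in> _\<close>] i]
        by (simp only: phase_mat_row)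
    qed
    then have "(\<Prod>i\<in>I. (phase_mat n q z * U) $$ (a i, c i)) =
        (\<Prod>i\<in>I. (if a i = q then z else 1) * U $$ (a i, c i))"
      by (intro prod.cong refl)
    also have "\<dots> = (\<Prod>i\<in>I. if a i = q then z else 1) * (\<Prod>i\<in>I. U $$ (a i, c i))"
      by (rule prod.distrib)
    also have "(\<Prod>i\<in>I. if a i = q then z else 1) = z ^ card {i \<in> I. a i = q}"
      using I by (subst prod.inter_filter[symmetric]) auto
    finally show ?thesis .
  qed
  have "moment \<mu> I a c b d = (\<integral>U. monomial I a c b d (phase_mat n q z * U) \<partial>\<mu>)"
    by (rule left_invariant[OF B abcd, symmetric])
  also have "\<dots> = (\<integral>U. z ^ card {i \<in> I. a i = q} * cnj z ^ card {i \<in> I. b i = q} *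
      monomial I a c b d U \<partial>\<mu>)"
    using abcd
    by (intro Bochner_Integration.integral_cong refl)
       (auto simp: space_eq monomial_def * simp del: cnj_prod)
  finally show ?thesis by (simp add: moment_def)
qed

text \<open>Multiplying row \<open>q\<close> by a unit number \<open>z\<close> multiplies the monomial by \<open>z\<close> to the
  difference of the two counts. A root of \<open>z ^ d = - 1\<close>, where \<open>d\<close> is the absolute difference,
  shows that the moment equals its own negative.\<close>

lemma moment_eq_0:
  assumes I: "finite I"
    and abcd: "a \<in> I \<rightarrow> {..<n}" "c \<in> I \<rightarrow> {..<n}" "b \<in> I \<rightarrow> {..<n}" "d \<in> I \<rightarrow> {..<n}"
    and neq: "card {i \<in> I. a i = q} \<noteq> card {i \<in> I. b i = q}"
  shows "moment \<mu> I a c b d = 0"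
proof -
  have *: "moment \<mu> I a c b d = 0" if z: "z * cnj z = 1"
    and "z ^ card {i \<in> I. a i = q} * cnj z ^ card {i \<in> I. b i = q} = - 1" for z
  proof -
    have "moment \<mu> I a c b d = - moment \<mu> I a c b d"
      using moment_phase[OF I z abcd, of q] that(2) by simp
    then show ?thesis by simp
  qed
  have unit: "cis t * cnj (cis t) = 1" for t by (simp add: cis_cnj cis_mult)
  have cis: "cis (pi / d) ^ d = - 1" if "d > 0" for d :: nat
  proof -
    have "cis (pi / d) ^ d = cis (real d * (pi / d))" by (rule Complex.DeMoivre)
    then show ?thesis using that by simp
  qed
  show ?thesis
  proof (cases "card {i \<in> I. a i = q} < card {i \<in> I. b i = q}")
    case True
    then obtain d where d: "card {i \<in> I. b i = q} = card {i \<in> I. a i = q} + d" "d > 0"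
      by (metis less_imp_add_positive)
    \<comment> \<open>The conjugate because here the conjugated entries are in excess.\<close>
    let ?z = "cnj (cis (pi / d))"
    have "?z ^ card {i \<in> I. a i = q} * cnj ?z ^ card {i \<in> I. b i = q} =
        (cis (pi / d) * cnj (cis (pi / d))) ^ card {i \<in> I. a i = q} * cis (pi / d) ^ d"
      by (simp add: d power_add power_mult_distrib del: cis_cnj)
    then show ?thesis
      using unit by (intro *[of ?z]) (auto simp: cis[OF d(2)] mult.commute simp del: cis_cnj)
  next
    case False
    with neq have "card {i \<in> I. b i = q} < card {i \<in> I. a i = q}" by simp
    then obtain d where d: "card {i \<in> I. a i = q} = card {i \<in> I. b i = q} + d" "d > 0"
      by (metis less_imp_add_positive)
    let ?z = "cis (pi / d)"
    have "?z ^ card {i \<in> I. a i = q} * cnj ?z ^ card {i \<in> I. b i = q} =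
        (cis (pi / d) * cnj (cis (pi / d))) ^ card {i \<in> I. b i = q} * cis (pi / d) ^ d"
      by (simp add: d power_add power_mult_distrib del: cis_cnj)
    then show ?thesis
      using unit by (intro *[of ?z]) (auto simp: cis[OF d(2)] simp del: cis_cnj)
  qed
qed

lemma moment_permute_rows:
  assumes I: "finite I" and \<rho>: "\<rho> permutes {..<n}"
    and abcd: "a \<in> I \<rightarrow> {..<n}" "c \<in> I \<rightarrow> {..<n}" "b \<in> I \<rightarrow> {..<n}" "d \<in> I \<rightarrow> {..<n}"
  shows "moment \<mu> I (\<rho> \<circ> a) c (\<rho> \<circ> b) d = moment \<mu> I a c b d"
proof -
  have B: "permutation_mat n \<rho> \<in> unitary_group n" by (rule permutation_mat_unitary[OF \<rho>])
  have *: "(\<Prod>i\<in>I. (permutation_mat n \<rho> * U) $$ (a i, c i)) = (\<Prod>i\<in>I. U $$ ((\<rho> \<circ> a) i, c i))"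
    if "U \<in> unitary_group n" "a \<in> I \<rightarrow> {..<n}" "c \<in> I \<rightarrow> {..<n}" for U a c
  proof (intro prod.cong refl)
    fix i assume "i \<in> I"
    then have i: "a i < n" "c i < n" using that by auto
    show "(permutation_mat n \<rho> * U) $$ (a i, c i) = U $$ ((\<rho> \<circ> a) i, c i)"
      using mult_entry[OF unitary_carrier[OF B] unitary_carrier[OF that(1)] i]
      by (simp only: permutation_mat_row[OF \<rho> i(1)] o_apply)
  qed
  have "moment \<mu> I a c b d = (\<integral>U. monomial I a c b d (permutation_mat n \<rho> * U) \<partial>\<mu>)"
    by (rule left_invariant[OF B abcd, symmetric])
  also have "\<dots> = moment \<mu> I (\<rho> \<circ> a) c (\<rho> \<circ> b) d"
    unfolding moment_def using abcd
    by (intro Bochner_Integration.integral_cong refl)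
       (auto simp: space_eq monomial_def * simp del: cnj_prod)
  finally show ?thesis ..
qed

text \<open>Since row \<open>p\<close> does not occur in the monomial, a rotation in the plane of \<open>p\<close> and \<open>q\<close>
  only affects the factors in row \<open>q\<close>, each of which becomes a sum of two terms. The sets \<open>S\<close> and
  \<open>S'\<close> record the factors that were moved to row \<open>p\<close>.\<close>

lemma moment_rotate:
  fixes u v :: real and a b :: "'i \<Rightarrow> nat"
  assumes I: "finite I"
    and abcd: "a \<in> I \<rightarrow> {..<n}" "c \<in> I \<rightarrow> {..<n}" "b \<in> I \<rightarrow> {..<n}" "d \<in> I \<rightarrow> {..<n}"
    and pq: "p < n" "q < n" "p \<noteq> q" and p: "p \<notin> a ` I" "p \<notin> b ` I"
    and uv: "u\<^sup>2 + v\<^sup>2 = 1"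
  defines "A \<equiv> {i \<in> I. a i = q}" and "A' \<equiv> {i \<in> I. b i = q}"
  shows "moment \<mu> I a c b d = (\<Sum>S\<in>Pow A. \<Sum>S'\<in>Pow A'.
    of_real (v ^ card S * u ^ (card A - card S) * (v ^ card S' * u ^ (card A' - card S'))) *
    moment \<mu> I (\<lambda>i. if i \<in> S then p else a i) c (\<lambda>i. if i \<in> S' then p else b i) d)"
proof -
  let ?B = "rotation_mat n p q u v"
  let ?s = "\<lambda>a S i. if i \<in> S then p else a i"
  have B: "?B \<in> unitary_group n" by (rule rotation_mat_unitary[OF uv pq])
  have *: "(\<Prod>i\<in>I. (?B * U) $$ (a i, c i)) = (\<Sum>S\<in>Pow {i \<in> I. a i = q}.
      of_real (v ^ card S * u ^ (card {i \<in> I. a i = q} - card S)) * (\<Prod>i\<in>I. U $$ (?s a S i, c i)))"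
    if U: "U \<in> unitary_group n" and ac: "a \<in> I \<rightarrow> {..<n}" "c \<in> I \<rightarrow> {..<n}" and p: "p \<notin> a ` I"
    for U a c
  proof -
    let ?A = "{i \<in> I. a i = q}"
    have entry: "(?B * U) $$ (a i, c i) =
        (if a i = q then of_real v * U $$ (p, c i) + of_real u * U $$ (q, c i) else U $$ (a i, c i))"
      if "i \<in> I" for i
    proof -
      have i: "a i < n" "c i < n" using ac that by auto
      have "(?B * U) $$ (a i, c i) = (\<Sum>l<n. ?B $$ (a i, l) * U $$ (l, c i))"
        by (rule mult_entry[OF unitary_carrier[OF B] unitary_carrier[OF U] i])
      then show ?thesis
        unfolding rotation_mat_row[OF i(1) pq] using p that by (cases "a i = q") auto
    qed
    have "(\<Prod>i\<in>I. (?B * U) $$ (a i, c i)) =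
        (\<Prod>i\<in>I - ?A. (?B * U) $$ (a i, c i)) * (\<Prod>i\<in>?A. (?B * U) $$ (a i, c i))"
      using I by (intro prod.subset_diff) auto
    also have "\<dots> = (\<Prod>i\<in>I - ?A. U $$ (a i, c i)) *
        (\<Prod>i\<in>?A. of_real v * U $$ (p, c i) + of_real u * U $$ (q, c i))"
    proof (intro arg_cong2[where f = "(*)"] prod.cong refl)
      fix i assume "i \<in> I - ?A"
      then show "(?B * U) $$ (a i, c i) = U $$ (a i, c i)" using entry[of i] by simp
    next
      fix i assume "i \<in> ?A"
      then show "(?B * U) $$ (a i, c i) = of_real v * U $$ (p, c i) + of_real u * U $$ (q, c i)"
        using entry[of i] by simp
    qed
    also have "\<dots> = (\<Sum>S\<in>Pow ?A. (\<Prod>i\<in>I - ?A. U $$ (a i, c i)) *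
        ((\<Prod>i\<in>S. of_real v * U $$ (p, c i)) * (\<Prod>i\<in>?A - S. of_real u * U $$ (q, c i))))"
      using I by (simp add: prod_add sum_distrib_left)
    also have "\<dots> = (\<Sum>S\<in>Pow ?A.
      of_real (v ^ card S * u ^ (card ?A - card S)) * (\<Prod>i\<in>I. U $$ (?s a S i, c i)))"
    proof (rule sum.cong[OF refl])
      fix S assume S: "S \<in> Pow ?A"
      then have fin: "finite S" "finite ?A" using I by (auto intro: finite_subset)
      have "(\<Prod>i\<in>I. U $$ (?s a S i, c i)) =
          (\<Prod>i\<in>I - ?A. U $$ (?s a S i, c i)) * (\<Prod>i\<in>?A. U $$ (?s a S i, c i))"
        using I by (intro prod.subset_diff) auto
      also have "(\<Prod>i\<in>?A. U $$ (?s a S i, c i)) =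
          (\<Prod>i\<in>?A - S. U $$ (?s a S i, c i)) * (\<Prod>i\<in>S. U $$ (?s a S i, c i))"
        using S fin by (intro prod.subset_diff) auto
      also have "(\<Prod>i\<in>I - ?A. U $$ (?s a S i, c i)) = (\<Prod>i\<in>I - ?A. U $$ (a i, c i))"
        using S by (intro prod.cong) auto
      also have "(\<Prod>i\<in>?A - S. U $$ (?s a S i, c i)) = (\<Prod>i\<in>?A - S. U $$ (q, c i))"
        using S by (intro prod.cong) auto
      also have "(\<Prod>i\<in>S. U $$ (?s a S i, c i)) = (\<Prod>i\<in>S. U $$ (p, c i))"
        by (intro prod.cong) auto
      finally show "(\<Prod>i\<in>I - ?A. U $$ (a i, c i)) *
        ((\<Prod>i\<in>S. of_real v * U $$ (p, c i)) * (\<Prod>i\<in>?A - S. of_real u * U $$ (q, c i))) =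
        of_real (v ^ card S * u ^ (card ?A - card S)) * (\<Prod>i\<in>I. U $$ (?s a S i, c i))"
        using S fin by (simp add: prod.distrib card_Diff_subset)
    qed
    finally show ?thesis .
  qed
  have int: "integrable \<mu> (monomial I (?s a S) c (?s b S') d)" for S S'
    using abcd pq by (intro monomial_integrable) auto
  have "moment \<mu> I a c b d = (\<integral>U. monomial I a c b d (?B * U) \<partial>\<mu>)"
    by (rule left_invariant[OF B abcd, symmetric])
  also have "\<dots> = (\<integral>U. (\<Sum>S\<in>Pow A. \<Sum>S'\<in>Pow A'.
    of_real (v ^ card S * u ^ (card A - card S) * (v ^ card S' * u ^ (card A' - card S'))) *
    monomial I (?s a S) c (?s b S') d U) \<partial>\<mu>)"
  proof (intro Bochner_Integration.integral_cong refl)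
    fix U assume "U \<in> space \<mu>"
    then have U: "U \<in> unitary_group n" by (simp add: space_eq)
    show "monomial I a c b d (?B * U) = (\<Sum>S\<in>Pow A. \<Sum>S'\<in>Pow A'.
      of_real (v ^ card S * u ^ (card A - card S) * (v ^ card S' * u ^ (card A' - card S'))) *
      monomial I (?s a S) c (?s b S') d U)"
      unfolding monomial_def *[OF U abcd(1,2) p(1)] *[OF U abcd(3,4) p(2)] A_def A'_def
      by (simp add: sum_product cnj_sum algebra_simps del: cnj_prod)
  qed
  also have "\<dots> = (\<Sum>S\<in>Pow A. \<Sum>S'\<in>Pow A'.
    of_real (v ^ card S * u ^ (card A - card S) * (v ^ card S' * u ^ (card A' - card S'))) *
    moment \<mu> I (?s a S) c (?s b S') d)"
    using int by (simp add: moment_def)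
  finally show ?thesis .
qed

text \<open>This is the relation that computes moments with repeated rows from moments with fewer
  repetitions. In the expansion of the rotated moment the terms with \<open>card S \<noteq> card S'\<close>
  vanish; with \<open>x\<close> the squared tangent of the angle, the rest says
  \<open>(1 + x) ^ r * T = (\<Sum>j\<le>r. x ^ j * T\<^sub>j)\<close>, where \<open>T\<close> is the given moment and
  \<open>T\<^sub>j\<close> is the sum of the moments with \<open>j\<close> factors moved on either side. This is an
  identity of polynomials in \<open>x\<close>, and the claim compares the coefficients of \<open>x\<close>.\<close>

lemma moment_split_row:
  fixes a b :: "'i \<Rightarrow> nat"
  assumes I: "finite I"
    and abcd: "a \<in> I \<rightarrow> {..<n}" "c \<in> I \<rightarrow> {..<n}" "b \<in> I \<rightarrow> {..<n}" "d \<in> I \<rightarrow> {..<n}"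
    and pq: "p < n" "q < n" "p \<noteq> q" and p: "p \<notin> a ` I" "p \<notin> b ` I"
    and r: "card {i \<in> I. a i = q} = r" "card {i \<in> I. b i = q} = r"
  shows "of_nat r * moment \<mu> I a c b d =
    (\<Sum>i\<in>{i \<in> I. a i = q}. \<Sum>i'\<in>{i \<in> I. b i = q}. moment \<mu> I (a(i := p)) c (b(i' := p)) d)"
proof -
  define A where "A = {i \<in> I. a i = q}"
  define A' where "A' = {i \<in> I. b i = q}"
  have A: "finite A" "finite A'" "card A = r" "card A' = r" "A \<subseteq> I" "A' \<subseteq> I"
    using I r by (auto simp: A_def A'_def)
  define T where "T S S' = moment \<mu> I (\<lambda>i. if i \<in> S then p else a i) c (\<lambda>i. if i \<in> S' then p else b i) d" for S S'
  have T_0: "T S S' = 0" if "S \<subseteq> A" "S' \<subseteq> A'" "card S \<noteq> card S'" for S S'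
    unfolding T_def
  proof (rule moment_eq_0[OF I _ abcd(2) _ abcd(4), where q = p])
    have "{i \<in> I. (if i \<in> S then p else a i) = p} = S" "{i \<in> I. (if i \<in> S' then p else b i) = p} = S'"
      using p that A by auto
    then show "card {i \<in> I. (if i \<in> S then p else a i) = p} \<noteq>
        card {i \<in> I. (if i \<in> S' then p else b i) = p}"
      using that by simp
  qed (use abcd pq in auto)
  let ?P = "\<Sum>S\<in>Pow A. \<Sum>S'\<in>Pow A'. if card S = card S' then monom (T S S') (card S) else 0"
  let ?Q = "Polynomial.smult (moment \<mu> I a c b d) ([:1, 1:] ^ r)"
  have eq: "poly ?P (of_real x) = poly ?Q (of_real x)" if "x \<ge> 0" for x :: real
  proof -
    \<comment> \<open>Cosine and sine of the angle whose tangent is the square root of \<open>x\<close>.\<close>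
    define u where "u = 1 / sqrt (1 + x)"
    define v where "v = sqrt (x / (1 + x))"
    have u2: "u\<^sup>2 = 1 / (1 + x)" and v2: "v\<^sup>2 = x / (1 + x)"
      using that by (auto simp: u_def v_def power_divide)
    have uv: "u\<^sup>2 + v\<^sup>2 = 1"
      using that by (simp add: u2 v2 field_simps)
    have coef: "v ^ j * u ^ (r - j) * (v ^ j * u ^ (r - j)) * (1 + x) ^ r = x ^ j" if "j \<le> r" for j
    proof -
      have "v ^ j * u ^ (r - j) * (v ^ j * u ^ (r - j)) = (v\<^sup>2) ^ j * (u\<^sup>2) ^ (r - j)"
        by (simp add: power2_eq_square power_mult_distrib)
      also have "\<dots> = x ^ j / ((1 + x) ^ j * (1 + x) ^ (r - j))"
        by (simp add: u2 v2 power_divide)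
      also have "(1 + x) ^ j * (1 + x) ^ (r - j) = (1 + x) ^ r"
        using that by (simp flip: power_add)
      finally show ?thesis using \<open>x \<ge> 0\<close> by simp
    qed
    have "poly ?Q (of_real x) = of_real ((1 + x) ^ r) * moment \<mu> I a c b d"
      by (simp add: mult.commute)
    also have "\<dots> = (\<Sum>S\<in>Pow A. \<Sum>S'\<in>Pow A'. of_real ((1 + x) ^ r) *
        (of_real (v ^ card S * u ^ (card A - card S) * (v ^ card S' * u ^ (card A' - card S'))) * T S S'))"
      by (subst moment_rotate[OF I abcd pq p uv])
         (simp add: sum_distrib_left T_def A_def A'_def)
    also have "\<dots> = (\<Sum>S\<in>Pow A. \<Sum>S'\<in>Pow A'. if card S = card S' then T S S' * of_real x ^ card S else 0)"
    proof (intro sum.cong refl)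
      fix S S' assume S: "S \<in> Pow A" "S' \<in> Pow A'"
      then have "card S \<le> r" using A card_mono by auto
      have "complex_of_real ((1 + x) ^ r) * (of_real (v ^ card S * u ^ (card A - card S) * (v ^ card S' * u ^ (card A' - card S'))) * T S S')
        = of_real (v ^ card S * u ^ (r - card S) * (v ^ card S * u ^ (r - card S)) * (1 + x) ^ r) * T S S'"
        if "card S = card S'"
        using that A by (simp add: mult_ac)
      also note coef[OF \<open>card S \<le> r\<close>]
      finally show "complex_of_real ((1 + x) ^ r) * (of_real (v ^ card S * u ^ (card A - card S) * (v ^ card S' * u ^ (card A' - card S'))) * T S S')
        = (if card S = card S' then T S S' * of_real x ^ card S else 0)"
        using T_0[of S S'] S by (auto simp: mult.commute)
    qed
    also have "\<dots> = poly ?P (of_real x)"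
      by (auto simp: poly_sum poly_monom intro!: sum.cong)
    finally show ?thesis ..
  qed
  have "?P = ?Q"
  proof (rule ccontr)
    assume "?P \<noteq> ?Q"
    then have "finite {z. poly (?P - ?Q) z = 0}" by (intro poly_roots_finite) simp
    moreover have "complex_of_real ` {0..} \<subseteq> {z. poly (?P - ?Q) z = 0}"
      using eq by auto
    ultimately have "finite (complex_of_real ` {0..})" by (rule finite_subset[rotated])
    then have "finite {0 :: real..}" by (rule finite_imageD) (auto simp: inj_on_def)
    then show False using infinite_Ici by blast
  qed
  then have "coeff ?Q 1 = coeff ?P 1" by simp
  also have "\<dots> = (\<Sum>S\<in>Pow A. if card S = 1 then (\<Sum>S'\<in>Pow A'. if card S' = 1 then T S S' else 0) else 0)"
    by (auto simp: coeff_sum intro!: sum.cong)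
  also have "\<dots> = (\<Sum>i\<in>A. \<Sum>i'\<in>A'. T {i} {i'})"
    by (simp only: sum_Pow_card_1[OF A(1)] sum_Pow_card_1[OF A(2)])
  also have "\<dots> = (\<Sum>i\<in>A. \<Sum>i'\<in>A'. moment \<mu> I (a(i := p)) c (b(i' := p)) d)"
    unfolding T_def by (intro sum.cong refl moment_cong) auto
  finally have "moment \<mu> I a c b d * coeff ([:1, 1:] ^ r) 1 =
    (\<Sum>i\<in>A. \<Sum>i'\<in>A'. moment \<mu> I (a(i := p)) c (b(i' := p)) d)" by simp
  moreover have "coeff ([:1, 1 :: complex:] ^ r) 1 = of_nat r"
    using coeff_linear_poly_power[of 1 r 1 "1 :: complex"] by (cases "r = 0") auto
  ultimately show ?thesis
    by (simp add: A_def A'_def mult.commute)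
qed

end

section \<open>Moments with pairwise distinct columns\<close>

lemma fiber_card_permuted:
  assumes \<sigma>: "\<sigma> permutes I" and ab: "\<And>i. i \<in> I \<Longrightarrow> a (\<sigma> i) = b i"
  shows "card {i \<in> I. a i = q} = card {i \<in> I. b i = q}"
proof -
  have "\<sigma> ` {i \<in> I. b i = q} = {i \<in> I. a i = q}"
  proof
    show "\<sigma> ` {i \<in> I. b i = q} \<subseteq> {i \<in> I. a i = q}"
      using ab permutes_in_image[OF \<sigma>] by auto
    show "{i \<in> I. a i = q} \<subseteq> \<sigma> ` {i \<in> I. b i = q}"
    proof
      fix i assume i: "i \<in> {i \<in> I. a i = q}"
      then obtain j where j: "i = \<sigma> j" using permutes_surj[OF \<sigma>] by (metis surjD)
      then show "i \<in> \<sigma> ` {i \<in> I. b i = q}"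
        using i ab[of j] permutes_in_image[OF \<sigma>, of j] by auto
    qed
  qed
  then show ?thesis
    using card_image[OF permutes_inj_on[OF \<sigma>]] by metis
qed

text \<open>Each fibre of the injective \<open>a\<close> has at most one element, hence so does each fibre of
  \<open>b\<close>: both functions enumerate the same values without repetition.\<close>

lemma ex_permutation_of_equal_fibers:
  fixes a b :: "'i \<Rightarrow> 'j"
  assumes I: "finite I" and inj: "inj_on a I"
    and fib: "\<And>q. card {i \<in> I. a i = q} = card {i \<in> I. b i = q}"
  obtains \<sigma> where "\<sigma> permutes I" "\<And>i. i \<in> I \<Longrightarrow> a (\<sigma> i) = b i"
proof -
  have "\<exists>i'\<in>I. a i' = b i" if "i \<in> I" for i
  proof -
    have "card {i' \<in> I. b i' = b i} \<noteq> 0" using I that by auto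
    then have "{i' \<in> I. a i' = b i} \<noteq> {}" using fib[of "b i"] by (metis card.empty)
    then show ?thesis by auto
  qed
  then obtain f where f: "f i \<in> I" "a (f i) = b i" if "i \<in> I" for i by metis
  have "inj_on b I"
  proof (rule inj_onI)
    fix i j assume ij: "i \<in> I" "j \<in> I" "b i = b j"
    have "{i' \<in> I. a i' = b i} = {f i}" using f[OF ij(1)] inj_onD[OF inj] by force
    then have "card {i' \<in> I. b i' = b i} = 1" using fib[of "b i"] by simp
    then obtain x where "{i' \<in> I. b i' = b i} = {x}" by (auto simp: card_1_singleton_iff)
    then show "i = j" using ij by (metis (mono_tags, lifting) mem_Collect_eq singletonD)
  qed
  then have "inj_on f I" using f by (metis inj_on_def)
  then have "(\<lambda>i. if i \<in> I then f i else i) permutes I"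
    using I f by (intro inj_imp_permutes) (auto simp: inj_on_def)
  then show ?thesis using f by (intro that) auto
qed

lemma ex_permutation_extending:
  fixes a :: "'i \<Rightarrow> 'i"
  assumes N: "finite N" and I: "I \<subseteq> N" and a: "inj_on a I" "a ` I \<subseteq> N"
  obtains \<rho> where "\<rho> permutes N" "\<And>i. i \<in> I \<Longrightarrow> \<rho> i = a i"
proof -
  have fin: "finite I" using N I by (rule finite_subset[rotated])
  have "card (N - I) = card (N - a ` I)"
    using N I a fin by (simp add: card_Diff_subset card_image)
  then obtain g where g: "bij_betw g (N - I) (N - a ` I)"
    using N by (metis finite_Diff finite_same_card_bij)
  let ?\<rho> = "\<lambda>i. if i \<in> I then a i else if i \<in> N then g i else i"
  have g': "g i \<in> N" "g i \<notin> a ` I" if "i \<in> N" "i \<notin> I" for i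
    using bij_betw_apply[OF g, of i] that by auto
  have g'': "g i \<noteq> a j" if "i \<in> N" "i \<notin> I" "j \<in> I" for i j
    using g'(2)[OF that(1,2)] that(3) by auto
  have "inj_on ?\<rho> N"
  proof (rule inj_onI)
    fix i j assume "i \<in> N" "j \<in> N" "?\<rho> i = ?\<rho> j"
    then show "i = j"
      using g''[of i j] g''[of j i] inj_onD[OF a(1), of i j] inj_onD[OF bij_betw_imp_inj_on[OF g], of i j]
      by (auto split: if_splits)
  qed
  then have "?\<rho> permutes N"
    using N I a g' by (intro inj_imp_permutes) auto
  then show ?thesis by (rule that) auto
qed

context haar_law
begin

text \<open>The part of the Weingarten formula that is needed, with the columns \<open>0, \<dots>, k - 1\<close> on both
  sides and arbitrary rows. Both sides vanish unless \<open>a\<close> and \<open>b\<close> take every value equally often.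
  If moreover \<open>a\<close> is injective, a permutation of all the rows brings \<open>a\<close> to the identity, and the
  right-hand side has the single term that results. Otherwise \<open>a\<close> misses a row \<open>p\<close>, because
  \<open>k \<le> n\<close>, and some row \<open>q\<close> is repeated; moving one factor from \<open>q\<close> to \<open>p\<close> enlarges
  the range of \<open>a\<close>, so the relation for splitting a row reduces the claim to wider ranges. The right-hand
  side satisfies the same relation: after moving \<open>i\<close> and \<open>i'\<close> to the fresh row, a permutation
  matches the two index functions if and only if it matched them before and sends \<open>i'\<close> to \<open>i\<close>.\<close>

lemma moment_distinct_columns:
  assumes k: "k \<le> n" and ab: "a \<in> {..<k} \<rightarrow> {..<n}" "b \<in> {..<k} \<rightarrow> {..<n}"
  shows "moment \<mu> {..<k} a id b id =
    (\<Sum>\<sigma> | \<sigma> permutes {..<k}. if \<forall>i<k. a (\<sigma> i) = b i then moment \<mu> {..<k} id id \<sigma> id else 0)"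
  using ab
proof (induction "k - card (a ` {..<k})" arbitrary: a b rule: less_induct)
  case less
  let ?I = "{..<k}" and ?w = "\<lambda>\<sigma>. moment \<mu> {..<k} id id \<sigma> id"
  let ?P = "{\<sigma>. \<sigma> permutes {..<k}}"
  have id: "id \<in> ?I \<rightarrow> {..<n}" using k by auto
  have finP: "finite ?P" by (rule finite_permutations) simp
  note abcd = less.prems(1) id less.prems(2) id
  show ?case
  proof (cases "\<forall>q. card {i \<in> ?I. a i = q} = card {i \<in> ?I. b i = q}")
    case False
    then obtain q where q: "card {i \<in> ?I. a i = q} \<noteq> card {i \<in> ?I. b i = q}" by blast
    have "moment \<mu> ?I a id b id = 0"
      by (rule moment_eq_0[OF _ abcd q]) simp
    moreover have "\<not> (\<forall>i<k. a (\<sigma> i) = b i)" if "\<sigma> permutes ?I" for \<sigma>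
      using fiber_card_permuted[OF that, of a b q] q by auto
    then have "(\<Sum>\<sigma>\<in>?P. if \<forall>i<k. a (\<sigma> i) = b i then ?w \<sigma> else 0) = 0"
      by (intro sum.neutral) auto
    ultimately show ?thesis by simp
  next
    case fib: True
    show ?thesis
    proof (cases "inj_on a ?I")
      case True
      obtain \<sigma> where \<sigma>: "\<sigma> permutes ?I" "\<And>i. i \<in> ?I \<Longrightarrow> a (\<sigma> i) = b i"
        using ex_permutation_of_equal_fibers[OF _ True, of b] fib by auto
      obtain \<rho> where \<rho>: "\<rho> permutes {..<n}" "\<And>i. i \<in> ?I \<Longrightarrow> \<rho> i = a i"
        using ex_permutation_extending[of "{..<n}" ?I a] True k less.prems(1) by auto
      have \<sigma>I: "\<sigma> i \<in> ?I" if "i \<in> ?I" for i using permutes_in_image[OF \<sigma>(1)] that by simp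
      have \<sigma>n: "\<sigma> \<in> ?I \<rightarrow> {..<n}"
      proof
        fix i assume "i \<in> ?I"
        then show "\<sigma> i \<in> {..<n}" using \<sigma>I[of i] k by simp
      qed
      have "moment \<mu> ?I a id b id = moment \<mu> ?I (\<rho> \<circ> id) id (\<rho> \<circ> \<sigma>) id"
        proof (rule moment_cong)
        fix i assume i: "i \<in> ?I"
        show "a i = (\<rho> \<circ> id) i" using \<rho>(2)[OF i] by simp
        show "b i = (\<rho> \<circ> \<sigma>) i" using \<rho>(2)[OF \<sigma>I[OF i]] \<sigma>(2)[OF i] by simp
      qed simp_all
      also have "\<dots> = ?w \<sigma>"
        by (rule moment_permute_rows[OF _ \<rho>(1) id id \<sigma>n id]) simp
      also have "?w \<sigma> = (\<Sum>\<tau>\<in>?P. if \<tau> = \<sigma> then ?w \<tau> else 0)"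
        using \<sigma>(1) finP by simp
      also have "\<dots> = (\<Sum>\<tau>\<in>?P. if \<forall>i<k. a (\<tau> i) = b i then ?w \<tau> else 0)"
      proof (intro sum.cong refl)
        fix \<tau> assume "\<tau> \<in> ?P"
        then have \<tau>: "\<tau> permutes ?I" by simp
        have "\<tau> = \<sigma>" if "\<forall>i<k. a (\<tau> i) = b i"
        proof
          fix i show "\<tau> i = \<sigma> i"
          proof (cases "i \<in> ?I")
            case i: True
            then have "a (\<tau> i) = a (\<sigma> i)" using that \<sigma>(2) by simp
            then show ?thesis
              using inj_onD[OF True] \<sigma>I[OF i] permutes_in_image[OF \<tau>] i by blast
          qed (use permutes_not_in[OF \<tau>] permutes_not_in[OF \<sigma>(1)] in simp)
        qed
        moreover have "\<forall>i<k. a (\<sigma> i) = b i" using \<sigma>(2) by simp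
        ultimately have "\<tau> = \<sigma> \<longleftrightarrow> (\<forall>i<k. a (\<tau> i) = b i)" by blast
        then show "(if \<tau> = \<sigma> then ?w \<tau> else 0) = (if \<forall>i<k. a (\<tau> i) = b i then ?w \<tau> else 0)"
          by (simp only:)
      qed
      finally show ?thesis .
    next
      case False
      then obtain j j' where j: "j \<in> ?I" "j' \<in> ?I" "a j = a j'" "j \<noteq> j'" by (auto simp: inj_on_def)
      have less_k: "card (a ` ?I) < k"
        using False eq_card_imp_inj_on[of ?I a] card_image_le[of ?I a] by fastforce
      have "\<not> {..<n} \<subseteq> a ` ?I"
        using card_mono[of "a ` ?I" "{..<n}"] less_k k by auto
      then obtain p where p: "p < n" "p \<notin> a ` ?I" by blast
      define q where "q = a j"
      define A where "A = {i \<in> ?I. a i = q}"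
      define A' where "A' = {i \<in> ?I. b i = q}"
      have q: "q < n" "p \<noteq> q" using j(1) less.prems(1) p(2) by (auto simp: q_def)
      have none: "{i \<in> ?I. a i = p} = {}" using p by blast
      have "card {i \<in> ?I. b i = p} = 0"
        using fib[rule_format, of p] unfolding none card.empty by (rule sym)
      then have "{i \<in> ?I. b i = p} = {}" by (subst (asm) card_0_eq) simp_all
      then have pb: "p \<notin> b ` ?I" by blast
      have cards: "card A = card A'" using fib by (simp add: A_def A'_def)
      have r: "card A > 0" using j by (auto simp: A_def q_def card_gt_0_iff)
      have finA: "finite A" "finite A'" by (auto simp: A_def A'_def)
      have IH: "moment \<mu> ?I (a(i := p)) id (b(i' := p)) id =
          (\<Sum>\<sigma>\<in>?P. if \<forall>l<k. (a(i := p)) (\<sigma> l) = (b(i' := p)) l then ?w \<sigma> else 0)"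
        if "i \<in> A" "i' \<in> A'" for i i'
      proof (rule less.hyps)
        obtain i2 where i2: "i2 \<in> ?I" "a i2 = a i" "i2 \<noteq> i"
        proof (cases "i = j")
          case True then show ?thesis using j by (intro that[of j']) auto
        next
          case False then show ?thesis using j \<open>i \<in> A\<close> by (intro that[of j]) (auto simp: A_def q_def)
        qed
        have "insert p (a ` ?I) \<subseteq> (a(i := p)) ` ?I"
        proof
          fix x assume "x \<in> insert p (a ` ?I)"
          then consider "x = p" | l where "l \<in> ?I" "l \<noteq> i" "x = a l" | "x = a i" by auto
          then show "x \<in> (a(i := p)) ` ?I"
          proof cases
            case 1 then show ?thesis using that by (auto simp: A_def intro!: image_eqI[of _ _ i])
          next
            case 2 then show ?thesis by (intro image_eqI[of _ _ l]) auto
          next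
            case 3 then show ?thesis using i2 by (intro image_eqI[of _ _ i2]) auto
          qed
        qed
        then have "card (insert p (a ` ?I)) \<le> card ((a(i := p)) ` ?I)" by (intro card_mono) auto
        then show "k - card ((a(i := p)) ` ?I) < k - card (a ` ?I)" using p less_k by simp
        show "a(i := p) \<in> ?I \<rightarrow> {..<n}" "b(i' := p) \<in> ?I \<rightarrow> {..<n}"
          using less.prems p by auto
      qed
      have match: "(\<forall>l<k. (a(i := p)) (\<sigma> l) = (b(i' := p)) l) \<longleftrightarrow> i = \<sigma> i' \<and> (\<forall>l<k. a (\<sigma> l) = b l)"
        if \<sigma>: "\<sigma> \<in> ?P" and i: "i \<in> A" "i' \<in> A'" for \<sigma> i i'
      proof
        have \<sigma>I: "\<sigma> l \<in> ?I" if "l < k" for l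
          using permutes_in_image[of \<sigma> ?I l] \<sigma> that by simp
        assume *: "\<forall>l<k. (a(i := p)) (\<sigma> l) = (b(i' := p)) l"
        have i'k: "i' < k" using i by (simp add: A'_def)
        have "(a(i := p)) (\<sigma> i') = p" using * i'k by simp
        then have eq: "i = \<sigma> i'" using p(2) \<sigma>I[OF i'k] by (metis fun_upd_other image_eqI)
        moreover have "a (\<sigma> l) = b l" if "l < k" for l
        proof (cases "l = i'")
          case True then show ?thesis using i eq by (simp add: A_def A'_def)
        next
          case False
          then have "\<sigma> l \<noteq> i" using eq \<sigma> permutes_inj[of \<sigma>] by (auto simp: inj_eq)
          then show ?thesis using *[rule_format, OF that] False by simp
        qed
        ultimately show "i = \<sigma> i' \<and> (\<forall>l<k. a (\<sigma> l) = b l)" by blast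
      next
        assume "i = \<sigma> i' \<and> (\<forall>l<k. a (\<sigma> l) = b l)"
        then show "\<forall>l<k. (a(i := p)) (\<sigma> l) = (b(i' := p)) l"
          using \<sigma> permutes_inj[of \<sigma>] by (auto simp: inj_eq)
      qed
      \<comment> \<open>Each \<open>\<sigma>\<close> with \<open>a \<circ> \<sigma> = b\<close> is counted once for every \<open>i'\<close> in \<open>A'\<close>, that is, \<open>card A\<close> times; this factor cancels.\<close>
      have "of_nat (card A) * moment \<mu> ?I a id b id =
          (\<Sum>i\<in>A. \<Sum>i'\<in>A'. moment \<mu> ?I (a(i := p)) id (b(i' := p)) id)"
        unfolding A_def A'_def
        by (rule moment_split_row[OF _ abcd p(1) q p(2) pb refl]) (use fib in auto)
      also have "\<dots> = (\<Sum>i\<in>A. \<Sum>i'\<in>A'. \<Sum>\<sigma>\<in>?P. if i = \<sigma> i' \<and> (\<forall>l<k. a (\<sigma> l) = b l) then ?w \<sigma> else 0)"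
      proof (intro sum.cong refl)
        fix i i' assume i: "i \<in> A" "i' \<in> A'"
        show "moment \<mu> ?I (a(i := p)) id (b(i' := p)) id =
            (\<Sum>\<sigma>\<in>?P. if i = \<sigma> i' \<and> (\<forall>l<k. a (\<sigma> l) = b l) then ?w \<sigma> else 0)"
          unfolding IH[OF i] by (intro sum.cong refl) (simp only: match[OF _ i])
      qed
      also have "\<dots> = (\<Sum>\<sigma>\<in>?P. \<Sum>i\<in>A. \<Sum>i'\<in>A'. if i = \<sigma> i' \<and> (\<forall>l<k. a (\<sigma> l) = b l) then ?w \<sigma> else 0)"
        by (simp only: sum.swap[of _ ?P])
      also have "\<dots> = (\<Sum>\<sigma>\<in>?P. of_nat (card A) * (if \<forall>l<k. a (\<sigma> l) = b l then ?w \<sigma> else 0))"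
      proof (intro sum.cong refl)
        fix \<sigma> assume \<sigma>: "\<sigma> \<in> ?P"
        show "(\<Sum>i\<in>A. \<Sum>i'\<in>A'. if i = \<sigma> i' \<and> (\<forall>l<k. a (\<sigma> l) = b l) then ?w \<sigma> else 0) =
          of_nat (card A) * (if \<forall>l<k. a (\<sigma> l) = b l then ?w \<sigma> else 0)"
        proof (cases "\<forall>l<k. a (\<sigma> l) = b l")
          case True
          have mem: "\<sigma> i' \<in> A" if "i' \<in> A'" for i'
            using that True permutes_in_image[of \<sigma> ?I i'] \<sigma> by (auto simp: A_def A'_def)
          have "(\<Sum>i\<in>A. \<Sum>i'\<in>A'. if i = \<sigma> i' then ?w \<sigma> else 0) = (\<Sum>i'\<in>A'. ?w \<sigma>)"
            by (subst sum.swap) (auto intro!: sum.cong simp: finA mem)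
          then show ?thesis using True cards by simp
        next
          case False
          then show ?thesis
            by (simp only: False simp_thms if_False sum.neutral_const mult_zero_right)
        qed
      qed
      also have "\<dots> = of_nat (card A) * (\<Sum>\<sigma>\<in>?P. if \<forall>l<k. a (\<sigma> l) = b l then ?w \<sigma> else 0)"
        by (simp only: sum_distrib_left)
      finally show ?thesis using r by simp
    qed
  qed
qed

section \<open>Moments of a single column\<close>

text \<open>Insert the squared norm of a column, which is \<open>1\<close>. The fresh index \<open>x\<close> carries the
  additional factor.\<close>

lemma moment_column_norm:
  assumes "finite I" "e \<in> I \<rightarrow> {..<n}" "c < n" "x \<notin> I"
  shows "moment \<mu> I e (\<lambda>_. c) e (\<lambda>_. c) =
    (\<Sum>j<n. moment \<mu> (insert x I) (e(x := j)) (\<lambda>_. c) (e(x := j)) (\<lambda>_. c))"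
proof -
  have mono: "monomial (insert x I) (e(x := j)) (\<lambda>_. c) (e(x := j)) (\<lambda>_. c) U =
      monomial I e (\<lambda>_. c) e (\<lambda>_. c) U * (U $$ (j, c) * cnj (U $$ (j, c)))" for U j
  proof -
    have "(\<Prod>i\<in>I. U $$ (if i = x then j else e i, c)) = (\<Prod>i\<in>I. U $$ (e i, c))"
      using assms(4) by (intro prod.cong) auto
    then show ?thesis using assms(1,4) by (simp add: monomial_def fun_upd_def mult_ac)
  qed
  have int: "integrable \<mu> (monomial (insert x I) (e(x := j)) (\<lambda>_. c) (e(x := j)) (\<lambda>_. c))"
    if "j < n" for j
    using assms that by (intro monomial_integrable) auto
  have "moment \<mu> I e (\<lambda>_. c) e (\<lambda>_. c) =
    (\<integral>U. (\<Sum>j<n. monomial (insert x I) (e(x := j)) (\<lambda>_. c) (e(x := j)) (\<lambda>_. c) U) \<partial>\<mu>)"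
    unfolding moment_def mono sum_distrib_left[symmetric]
    using assms(3) by (intro Bochner_Integration.integral_cong refl)
      (simp add: space_eq unitary_columns)
  then show ?thesis using int by (simp add: moment_def)
qed

text \<open>A column is uniformly distributed on the sphere; the formula gives the mean of the product of
  \<open>\<bar>u\<^sub>j\<bar>\<^sup>2\<close> over \<open>j \<in> J\<close>. In the induction step the mean for \<open>J\<close> is written, by the norm of
  the column, as the sum over \<open>j < n\<close> of the means \<open>X j\<close> with one more factor
  \<open>\<bar>u\<^sub>j\<bar>\<^sup>2\<close>. For \<open>j \<notin> J\<close> all \<open>X j\<close> agree. For \<open>j \<in> J\<close> row \<open>j\<close>
  occurs twice; splitting it gives \<open>2 * X j = 4 * X p\<close>. The sum is therefore
  \<open>(n - card J) + 2 * card J = n + card J\<close> times the mean for \<open>insert p J\<close>.\<close>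

lemma moment_column:
  assumes "J \<subseteq> {..<n}" "c < n"
  shows "moment \<mu> J id (\<lambda>_. c) id (\<lambda>_. c) = 1 / pochhammer (of_nat n) (card J)"
proof -
  have "finite J" using assms(1) finite_subset by blast
  then show ?thesis using assms(1)
  proof (induction J rule: finite_induct)
    case empty
    then show ?case by (simp add: moment_def monomial_def prob_space)
  next
    case (insert p J)
    let ?C = "\<lambda>_ :: nat. c"
    \<comment> \<open>The index \<open>n\<close> is not the number of a row, so it is fresh for \<open>J\<close>.\<close>
    define X where "X j = moment \<mu> (insert n J) (id(n := j)) ?C (id(n := j)) ?C" for j
    have nJ: "n \<notin> J" "p < n" using insert by auto
    have Xe: "(\<Prod>i\<in>insert n J. U $$ ((id(n := p)) i, c)) = U $$ (p, c) * (\<Prod>i\<in>J. U $$ (i, c))"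
      for U :: "complex mat"
    proof -
      have "(\<Prod>i\<in>J. U $$ ((id(n := p)) i, c)) = (\<Prod>i\<in>J. U $$ (i, c))"
        using nJ by (intro prod.cong) auto
      then show ?thesis using insert.hyps nJ by simp
    qed
    have X_cong: "moment \<mu> (insert n J) e ?C e' ?C = X p"
      if "\<And>U :: complex mat. (\<Prod>i\<in>insert n J. U $$ (e i, c)) = U $$ (p, c) * (\<Prod>i\<in>J. U $$ (i, c))"
        "\<And>U :: complex mat. (\<Prod>i\<in>insert n J. U $$ (e' i, c)) = U $$ (p, c) * (\<Prod>i\<in>J. U $$ (i, c))"
      for e e'
      unfolding X_def moment_def monomial_def that Xe ..
    have X_p: "X p = moment \<mu> (insert p J) id ?C id ?C"
      unfolding X_def moment_def monomial_def Xe using insert.hyps by simp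
    have split: "of_nat (card {i \<in> insert n J. (id(n := j)) i = j}) * X j =
        (\<Sum>i\<in>{i \<in> insert n J. (id(n := j)) i = j}. \<Sum>i'\<in>{i \<in> insert n J. (id(n := j)) i = j}.
          moment \<mu> (insert n J) ((id(n := j))(i := p)) ?C ((id(n := j))(i' := p)) ?C)"
      if "j < n" "j \<noteq> p" for j
      unfolding X_def using insert assms(2) that nJ
      by (intro moment_split_row) auto
    have X_new: "X j = X p" if j: "j < n" "j \<notin> J" "j \<noteq> p" for j
    proof -
      have "{i \<in> insert n J. (id(n := j)) i = j} = {n}" using j by auto
      then show ?thesis using split[OF j(1,3)] by (simp add: X_def)
    qed
    have X_old: "X j = 2 * X p" if j: "j \<in> J" for j
    proof -
      have jn: "j < n" "j \<noteq> p" "j \<noteq> n" using insert j by auto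
      have A: "{i \<in> insert n J. (id(n := j)) i = j} = {n, j}" using j by auto
      have e: "(\<Prod>i\<in>insert n J. U $$ (((id(n := j))(i0 := p)) i, c)) =
          U $$ (p, c) * (\<Prod>i\<in>J. U $$ (i, c))" if "i0 \<in> {n, j}" for U :: "complex mat" and i0
      proof (cases "i0 = n")
        case True
        have "(\<Prod>i\<in>J. U $$ (((id(n := j))(n := p)) i, c)) = (\<Prod>i\<in>J. U $$ (i, c))"
          using nJ by (intro prod.cong) auto
        then show ?thesis using insert.hyps nJ True by simp
      next
        case False
        then have i0: "i0 = j" using that by simp
        have "(\<Prod>i\<in>J. U $$ (((id(n := j))(j := p)) i, c)) = U $$ (p, c) * (\<Prod>i\<in>J - {j}. U $$ (i, c))"
        proof -
          have "(\<Prod>i\<in>J - {j}. U $$ (((id(n := j))(j := p)) i, c)) = (\<Prod>i\<in>J - {j}. U $$ (i, c))"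
            using nJ by (intro prod.cong) auto
          then show ?thesis
            using prod.remove[OF insert.hyps(1) j, of "\<lambda>i. U $$ (((id(n := j))(j := p)) i, c)"]
            by simp
        qed
        moreover have "(\<Prod>i\<in>J. U $$ (i, c)) = U $$ (j, c) * (\<Prod>i\<in>J - {j}. U $$ (i, c))"
          by (rule prod.remove[OF insert.hyps(1) j])
        ultimately show ?thesis using insert.hyps nJ jn i0 by simp
      qed
      have "of_nat 2 * X j = (\<Sum>i\<in>{n, j}. \<Sum>i'\<in>{n, j}. X p)"
        using split[OF jn(1,2)] jn unfolding A
        by (simp add: X_cong[OF e e] del: sum.insert fun_upd_apply fun_upd_upd)
      then show ?thesis using jn by simp
    qed
    have "moment \<mu> J id ?C id ?C = (\<Sum>j<n. X j)"
      unfolding X_def using insert assms(2) nJ by (intro moment_column_norm) auto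
    also have "\<dots> = (\<Sum>j\<in>{..<n} - J. X j) + (\<Sum>j\<in>J. X j)"
      using insert by (intro sum.subset_diff) auto
    also have "(\<Sum>j\<in>{..<n} - J. X j) = (\<Sum>j\<in>{..<n} - J. X p)"
      using X_new by (intro sum.cong) (metis DiffD1 DiffD2 lessThan_iff)+
    also have "(\<Sum>j\<in>J. X j) = (\<Sum>j\<in>J. 2 * X p)"
      by (intro sum.cong) (auto simp: X_old)
    also have "(\<Sum>j\<in>{..<n} - J. X p) + (\<Sum>j\<in>J. 2 * X p) = (of_nat n + of_nat (card J)) * X p"
    proof -
      have "card J \<le> n" using insert card_mono[of "{..<n}" J] by simp
      then show ?thesis using insert by (simp add: card_Diff_subset of_nat_diff algebra_simps)
    qed
    finally have "moment \<mu> J id ?C id ?C = (of_nat n + of_nat (card J)) * X p" .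
    moreover have N: "of_nat n + of_nat (card J) \<noteq> (0 :: complex)"
      using nJ by (metis add_is_0 not_less_zero of_nat_add of_nat_eq_0_iff)
    ultimately have "X p = moment \<mu> J id ?C id ?C / (of_nat n + of_nat (card J))"
      by simp
    moreover have "moment \<mu> J id ?C id ?C = 1 / pochhammer (of_nat n) (card J)"
      by (rule insert.IH) (use insert.prems in simp)
    ultimately show ?case
      unfolding X_p by (simp only: card_insert_disjoint[OF insert.hyps] pochhammer_Suc divide_divide_eq_left)
  qed
qed

end

section \<open>The ascension identity\<close>

lemma sum_Pow_card:
  fixes g :: "nat \<Rightarrow> 'b :: comm_semiring_1"
  assumes "finite F"
  shows "(\<Sum>S\<in>Pow F. g (card S)) = (\<Sum>t = 0..card F. of_nat (card F choose t) * g t)"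
proof -
  have "(\<Sum>S\<in>Pow F. g (card S)) = (\<Sum>t\<in>{0..card F}. \<Sum>S\<in>{S \<in> Pow F. card S = t}. g (card S))"
    using assms by (intro sum.group[symmetric]) (auto intro: card_mono)
  also have "\<dots> = (\<Sum>t\<in>{0..card F}. of_nat (card F choose t) * g t)"
  proof (intro sum.cong refl)
    fix t
    have "{S \<in> Pow F. card S = t} = {S. S \<subseteq> F \<and> card S = t}" by auto
    then show "(\<Sum>S\<in>{S \<in> Pow F. card S = t}. g (card S)) = of_nat (card F choose t) * g t"
      using n_subsets[OF assms, of t] by simp
  qed
  finally show ?thesis .
qed

definition extend_mat :: "nat \<Rightarrow> complex mat \<Rightarrow> complex mat" where
  "extend_mat m V = mat (Suc m) (Suc m)
     (\<lambda>(i, j). if i < m \<and> j < m then V $$ (i, j) else if i = j then 1 else 0)"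

lemma extend_mat_unitary:
  assumes "V \<in> unitary_group m"
  shows "extend_mat m V \<in> unitary_group (Suc m)"
proof (rule unitary_groupI)
  show "extend_mat m V \<in> carrier_mat (Suc m) (Suc m)" by (simp add: extend_mat_def)
  fix i j assume "i < Suc m" "j < Suc m"
  then show "(\<Sum>l<Suc m. extend_mat m V $$ (i, l) * cnj (extend_mat m V $$ (j, l))) =
      (if i = j then 1 else 0)"
    using unitary_rows[OF assms, of i j]
    by (cases "i < m"; cases "j < m") (auto simp: extend_mat_def)
qed

text \<open>Left invariance under the block matrix of \<open>V\<close> and \<open>1\<close>, averaged over \<open>V\<close>. The rows of the
  block matrix with index below \<open>m\<close> vanish in the last column, so only index functions with values
  below \<open>m\<close> survive.\<close>

lemma moment_restrict:
  assumes \<mu>: "haar_law (Suc m) \<mu>" and \<nu>: "haar_law m \<nu>" and I: "finite I"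
    and ab: "a \<in> I \<rightarrow> {..<m}" "b \<in> I \<rightarrow> {..<m}" and cd: "c \<in> I \<rightarrow> {..<Suc m}" "d \<in> I \<rightarrow> {..<Suc m}"
  shows "moment \<mu> I a c b d =
    (\<Sum>l\<in>I \<rightarrow>\<^sub>E {..<m}. \<Sum>l'\<in>I \<rightarrow>\<^sub>E {..<m}. moment \<nu> I a l b l' * moment \<mu> I l c l' d)"
proof -
  interpret \<mu>: haar_law "Suc m" \<mu> by (rule \<mu>)
  interpret \<nu>: haar_law m \<nu> by (rule \<nu>)
  let ?L = "I \<rightarrow>\<^sub>E {..<m}"
  have fin: "finite (I \<rightarrow>\<^sub>E {..<Suc m})" using I by (intro finite_PiE) auto
  have sub: "?L \<subseteq> I \<rightarrow>\<^sub>E {..<Suc m}" by (intro PiE_mono) auto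
  have exp: "moment \<mu> I a c b d =
      (\<Sum>l\<in>?L. \<Sum>l'\<in>?L. monomial I a l b l' V * moment \<mu> I l c l' d)"
    if V: "V \<in> unitary_group m" for V
  proof -
    let ?V = "extend_mat m V"
    have zero: "(\<Prod>i\<in>I. ?V $$ (a i, l i)) = 0"
      if a: "a \<in> I \<rightarrow> {..<m}" and l: "l \<in> (I \<rightarrow>\<^sub>E {..<Suc m}) - ?L" for a l
    proof -
      from l obtain i where i: "i \<in> I" "\<not> l i < m" "l i < Suc m" by (auto simp: PiE_iff)
      moreover have "a i < m" using a i by auto
      ultimately have "?V $$ (a i, l i) = 0" by (simp add: extend_mat_def)
      then show ?thesis using I i(1) by (intro prod_zero) auto
    qed
    have same: "(\<Prod>i\<in>I. ?V $$ (a i, l i)) = (\<Prod>i\<in>I. V $$ (a i, l i))"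
      if a: "a \<in> I \<rightarrow> {..<m}" and l: "l \<in> ?L" for a l
    proof (intro prod.cong refl)
      fix i assume "i \<in> I"
      then have "a i < m" "l i < m" using a l by (auto simp: PiE_iff)
      then show "?V $$ (a i, l i) = V $$ (a i, l i)" by (simp add: extend_mat_def)
    qed
    have "moment \<mu> I a c b d = (\<Sum>l\<in>I \<rightarrow>\<^sub>E {..<Suc m}. \<Sum>l'\<in>I \<rightarrow>\<^sub>E {..<Suc m}.
        monomial I a l b l' ?V * moment \<mu> I l c l' d)"
    proof (rule \<mu>.moment_expand[OF extend_mat_unitary[OF V] I _ cd(1) _ cd(2)])
      show "a \<in> I \<rightarrow> {..<Suc m}" "b \<in> I \<rightarrow> {..<Suc m}"
        using ab by (auto intro: less_SucI)
    qed
    also have "\<dots> = (\<Sum>l\<in>?L. \<Sum>l'\<in>I \<rightarrow>\<^sub>E {..<Suc m}. monomial I a l b l' ?V * moment \<mu> I l c l' d)"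
      using zero[OF ab(1)]
      by (intro sum.mono_neutral_right fin sub) (auto simp: monomial_def intro!: sum.neutral)
    also have "\<dots> = (\<Sum>l\<in>?L. \<Sum>l'\<in>?L. monomial I a l b l' ?V * moment \<mu> I l c l' d)"
      using zero[OF ab(2)]
      by (intro sum.cong refl sum.mono_neutral_right fin sub) (auto simp: monomial_def simp del: cnj_prod)
    also have "\<dots> = (\<Sum>l\<in>?L. \<Sum>l'\<in>?L. monomial I a l b l' V * moment \<mu> I l c l' d)"
      by (intro sum.cong refl) (simp add: monomial_def same ab del: cnj_prod)
    finally show ?thesis .
  qed
  have int: "integrable \<nu> (monomial I a l b l')" if "l \<in> ?L" "l' \<in> ?L" for l l'
    using that ab by (intro \<nu>.monomial_integrable) (auto simp: PiE_def)
  have "moment \<mu> I a c b d = (\<integral>V. moment \<mu> I a c b d \<partial>\<nu>)"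
    by (simp add: \<nu>.prob_space)
  also have "\<dots> = (\<integral>V. (\<Sum>l\<in>?L. \<Sum>l'\<in>?L. monomial I a l b l' V * moment \<mu> I l c l' d) \<partial>\<nu>)"
    by (intro Bochner_Integration.integral_cong refl exp) (simp add: \<nu>.space_eq)
  also have "\<dots> = (\<Sum>l\<in>?L. \<Sum>l'\<in>?L. moment \<nu> I a l b l' * moment \<mu> I l c l' d)"
    using int by (simp add: moment_def[symmetric])
  finally show ?thesis .
qed

lemma prod_permuted_pair:
  assumes "\<sigma> permutes I"
  shows "(\<Prod>i\<in>I. f (l (\<sigma> i)) i) = (\<Prod>i\<in>I. f (l i) (inv_into UNIV \<sigma> i))"
  using prod.permute[OF assms, of "\<lambda>i. f (l i) (inv_into UNIV \<sigma> i)"]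
  by (simp add: permutes_inverses(2)[OF assms] o_def)

context haar_law
begin

text \<open>The entries of row \<open>m\<close>, read as a column, form a unit vector \<open>v\<close>, and the
  factors are entries of the projection onto its orthogonal complement. Expand the product and let \<open>S\<close> be the set of
  positions where the Kronecker delta is chosen: it has to consist of fixed points of \<open>\<tau>\<close>, and its
  complement is invariant under \<open>\<tau>\<close>, so what remains is the product of the squared moduli of the
  entries of \<open>v\<close> over the complement. Grouping the sets \<open>S\<close> by their size gives the
  ascension function.\<close>

lemma projection_moment:
  assumes m: "m < n" and k: "k \<le> n" and \<tau>: "\<tau> permutes {..<k}"
  shows "(\<integral>U. (\<Prod>j<k. (if j = \<tau> j then 1 else 0) - U $$ (m, j) * cnj (U $$ (m, \<tau> j))) \<partial>\<mu>) =
    ascension k n \<tau>"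
proof -
  let ?I = "{..<k}"
  define F where "F = {i \<in> ?I. \<tau> i = i}"
  have F: "finite F" "F \<subseteq> ?I" by (auto simp: F_def)
  let ?M = "\<lambda>S. monomial (?I - S) (\<lambda>_. m) id (\<lambda>_. m) id"
  have "(\<Prod>j<k. (if j = \<tau> j then 1 else 0) - U $$ (m, j) * cnj (U $$ (m, \<tau> j))) =
      (\<Sum>S\<in>Pow F. (- 1) ^ (k - card S) * ?M S U)" for U
  proof -
    let ?g = "\<lambda>j. - (U $$ (m, j) * cnj (U $$ (m, \<tau> j)))"
    have "(\<Prod>j<k. (if j = \<tau> j then 1 else 0) - U $$ (m, j) * cnj (U $$ (m, \<tau> j))) =
        (\<Prod>j<k. (if j = \<tau> j then 1 else 0) + ?g j)" by simp
    also have "\<dots> = (\<Sum>S\<in>Pow ?I. (\<Prod>j\<in>S. if j = \<tau> j then 1 else 0) * (\<Prod>j\<in>?I - S. ?g j))"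
      by (rule prod_add) simp
    also have "\<dots> = (\<Sum>S\<in>Pow F. (\<Prod>j\<in>S. if j = \<tau> j then 1 else 0) * (\<Prod>j\<in>?I - S. ?g j))"
    proof (rule sum.mono_neutral_right)
      show "\<forall>S\<in>Pow ?I - Pow F. (\<Prod>j\<in>S. if j = \<tau> j then 1 else 0) * (\<Prod>j\<in>?I - S. ?g j) = 0"
      proof
        fix S assume S: "S \<in> Pow ?I - Pow F"
        then obtain j where "j \<in> S" "j \<notin> F" "j \<in> ?I" by blast
        then have j: "j \<noteq> \<tau> j" unfolding F_def by auto
        have "finite S" using S finite_subset[of S ?I] by blast
        then have "(\<Prod>j\<in>S. if j = \<tau> j then 1 else 0 :: complex) = 0"
          using \<open>j \<in> S\<close> j by (intro prod_zero bexI[of _ j]) simp_all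
        then show "(\<Prod>j\<in>S. if j = \<tau> j then 1 else 0) * (\<Prod>j\<in>?I - S. ?g j) = 0" by simp
      qed
    qed (use F in auto)
    also have "\<dots> = (\<Sum>S\<in>Pow F. (- 1) ^ (k - card S) * ?M S U)"
    proof (intro sum.cong refl)
      fix S assume S: "S \<in> Pow F"
      then have fin: "finite S" using F finite_subset by blast
      have one: "(\<Prod>j\<in>S. if j = \<tau> j then 1 else 0 :: complex) = 1"
      proof (intro prod.neutral ballI)
        fix j assume "j \<in> S"
        then have "\<tau> j = j" using S by (auto simp: F_def)
        then show "(if j = \<tau> j then 1 else 0 :: complex) = 1" by simp
      qed
      have "\<tau> ` (?I - S) = ?I - S"
      proof -
        have "\<tau> ` S = id ` S" using S by (intro image_cong) (auto simp: F_def)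
        then show ?thesis
          using image_set_diff[OF permutes_inj[OF \<tau>], of ?I S] by (simp add: permutes_image[OF \<tau>])
      qed
      have card: "card (?I - S) = k - card S"
        using S F fin by (subst card_Diff_subset) auto
      from \<open>\<tau> ` (?I - S) = ?I - S\<close> have bij: "bij_betw \<tau> (?I - S) (?I - S)"
        using permutes_inj_on[OF \<tau>] by (simp add: bij_betw_def)
      have "(\<Prod>j\<in>?I - S. ?g j) = (\<Prod>j\<in>?I - S. - 1) *
          ((\<Prod>j\<in>?I - S. U $$ (m, j)) * cnj (\<Prod>j\<in>?I - S. U $$ (m, \<tau> j)))"
        unfolding cnj_prod prod.distrib[symmetric] by simp
      also have "(\<Prod>j\<in>?I - S. U $$ (m, \<tau> j)) = (\<Prod>j\<in>?I - S. U $$ (m, j))"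
        by (rule prod.reindex_bij_betw[OF bij])
      finally show "(\<Prod>j\<in>S. if j = \<tau> j then 1 else 0) * (\<Prod>j\<in>?I - S. ?g j) =
          (- 1) ^ (k - card S) * ?M S U"
        unfolding one monomial_def id_apply prod_constant card by simp
    qed
    finally show ?thesis .
  qed
  then have "(\<integral>U. (\<Prod>j<k. (if j = \<tau> j then 1 else 0) - U $$ (m, j) * cnj (U $$ (m, \<tau> j))) \<partial>\<mu>) =
      (\<integral>U. (\<Sum>S\<in>Pow F. (- 1) ^ (k - card S) * ?M S U) \<partial>\<mu>)" by simp
  also have "\<dots> = (\<Sum>S\<in>Pow F. (- 1) ^ (k - card S) * moment \<mu> (?I - S) (\<lambda>_. m) id (\<lambda>_. m) id)"
  proof -
    have "integrable \<mu> (?M S)" for S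
      using m k by (intro monomial_integrable) auto
    then show ?thesis by (simp add: moment_def)
  qed
  also have "\<dots> = (\<Sum>S\<in>Pow F. (- 1) ^ (k - card S) * (1 / pochhammer (of_nat n) (k - card S)))"
  proof (intro sum.cong refl)
    fix S assume S: "S \<in> Pow F"
    then have fin: "finite S" using F finite_subset by blast
    have "moment \<mu> (?I - S) (\<lambda>_. m) id (\<lambda>_. m) id = moment \<mu> (?I - S) id (\<lambda>_. m) id (\<lambda>_. m)"
      using m k by (intro moment_adjoint) auto
    also have "\<dots> = 1 / pochhammer (of_nat n) (card (?I - S))"
      using m k by (intro moment_column) auto
    also have "card (?I - S) = k - card S"
      using S F fin by (subst card_Diff_subset) auto
    finally show "(- 1) ^ (k - card S) * moment \<mu> (?I - S) (\<lambda>_. m) id (\<lambda>_. m) id =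
      (- 1) ^ (k - card S) * (1 / pochhammer (of_nat n) (k - card S))"
      by (simp only:)
  qed
  also have "\<dots> = ascension k n \<tau>"
    by (subst sum_Pow_card[OF F(1), of "\<lambda>t. (- 1) ^ (k - t) * (1 / pochhammer (of_nat n) (k - t))"])
       (simp add: ascension_def fixed_points_def F_def mult_ac)
  finally show ?thesis .
qed

end

lemma weingarten_moment: "weingarten k \<mu> \<pi> = moment \<mu> {..<k} id id id \<pi>"
  by (simp add: weingarten_def moment_def monomial_def)

lemma weingarten_inverse_moment:
  assumes "\<sigma> permutes {..<k}"
  shows "moment \<mu> {..<k} id id \<sigma> id = weingarten k \<mu> (inv_into UNIV \<sigma>)"
proof -
  have "(\<Prod>i<k. U $$ (\<sigma> i, i)) = (\<Prod>i<k. U $$ (i, inv_into UNIV \<sigma> i))" for U :: "complex mat"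
    using prod_permuted_pair[OF assms, of "\<lambda>i j. U $$ (i, j)" "\<lambda>i. i"] .
  then show ?thesis
    unfolding weingarten_moment moment_def monomial_def id_apply by (simp only:)
qed

text \<open>Summing over the row index \<open>l i < m\<close> leaves, by the orthogonality of the columns, a Kronecker
  delta minus the contribution of the last row.\<close>

lemma moment_row_sum:
  assumes \<mu>: "haar_law (Suc m) \<mu>" and k: "k \<le> m"
    and \<sigma>: "\<sigma> permutes {..<k}" and \<pi>: "\<pi> permutes {..<k}"
  shows "(\<Sum>l\<in>{..<k} \<rightarrow>\<^sub>E {..<m}. moment \<mu> {..<k} (l \<circ> \<sigma>) id l \<pi>) = ascension k (Suc m) (\<pi> \<circ> \<sigma>)"
proof -
  interpret haar_law "Suc m" \<mu> by (rule \<mu>)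
  let ?I = "{..<k}" and ?s = "inv_into UNIV \<sigma>"
  have \<sigma>I: "\<sigma> i < k" "\<pi> i < k" "?s i < k" if "i < k" for i
    using permutes_in_image[OF \<sigma>, of i] permutes_in_image[OF \<pi>, of i]
      permutes_in_image[OF permutes_inv[OF \<sigma>], of i] that by auto
  have int: "integrable \<mu> (monomial ?I (l \<circ> \<sigma>) id l \<pi>)" if "l \<in> ?I \<rightarrow>\<^sub>E {..<m}" for l
  proof (rule monomial_integrable)
    have l: "l i < Suc m" if "i < k" for i
      using PiE_mem[OF \<open>l \<in> _\<close>, of i] that by simp
    show "l \<circ> \<sigma> \<in> ?I \<rightarrow> {..<Suc m}" "l \<in> ?I \<rightarrow> {..<Suc m}" using l \<sigma>I(1) by simp_all
    have "i < Suc m" if "i < k" for i using that k by simp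
    then show "id \<in> ?I \<rightarrow> {..<Suc m}" "\<pi> \<in> ?I \<rightarrow> {..<Suc m}" using \<sigma>I(2) by simp_all
  qed
  have entries: "(\<Sum>l\<in>?I \<rightarrow>\<^sub>E {..<m}. monomial ?I (l \<circ> \<sigma>) id l \<pi> U) =
      (\<Prod>j<k. (if j = (\<pi> \<circ> \<sigma>) j then 1 else 0) - U $$ (m, j) * cnj (U $$ (m, (\<pi> \<circ> \<sigma>) j)))"
    if U: "U \<in> unitary_group (Suc m)" for U
  proof -
    have "(\<Sum>l\<in>?I \<rightarrow>\<^sub>E {..<m}. monomial ?I (l \<circ> \<sigma>) id l \<pi> U) =
        (\<Sum>l\<in>?I \<rightarrow>\<^sub>E {..<m}. \<Prod>i<k. U $$ (l i, ?s i) * cnj (U $$ (l i, \<pi> i)))"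
      using prod_permuted_pair[OF \<sigma>, of "\<lambda>i j. U $$ (i, j)"]
      by (simp add: monomial_def prod.distrib)
    also have "\<dots> = (\<Prod>i<k. \<Sum>l<m. U $$ (l, ?s i) * cnj (U $$ (l, \<pi> i)))"
      by (subst prod_sum_PiE) auto
    also have "\<dots> = (\<Prod>i<k. (if ?s i = \<pi> i then 1 else 0) - U $$ (m, ?s i) * cnj (U $$ (m, \<pi> i)))"
    proof (intro prod.cong refl)
      fix i assume "i \<in> ?I"
      then show "(\<Sum>l<m. U $$ (l, ?s i) * cnj (U $$ (l, \<pi> i))) =
          (if ?s i = \<pi> i then 1 else 0) - U $$ (m, ?s i) * cnj (U $$ (m, \<pi> i))"
        using unitary_columns[OF U, of "?s i" "\<pi> i"] \<sigma>I[of i] k by (simp add: eq_diff_eq)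
    qed
    also have "\<dots> = (\<Prod>j<k. (if ?s (\<sigma> j) = \<pi> (\<sigma> j) then 1 else 0)
        - U $$ (m, ?s (\<sigma> j)) * cnj (U $$ (m, \<pi> (\<sigma> j))))"
      by (subst prod.permute[OF \<sigma>]) (simp add: o_def)
    finally show ?thesis
      unfolding permutes_inverses(2)[OF \<sigma>] o_apply .
  qed
  have "(\<Sum>l\<in>?I \<rightarrow>\<^sub>E {..<m}. moment \<mu> ?I (l \<circ> \<sigma>) id l \<pi>) =
      (\<integral>U. (\<Sum>l\<in>?I \<rightarrow>\<^sub>E {..<m}. monomial ?I (l \<circ> \<sigma>) id l \<pi> U) \<partial>\<mu>)"
    using int by (simp add: moment_def)
  also have "\<dots> = (\<integral>U. (\<Prod>j<k. (if j = (\<pi> \<circ> \<sigma>) j then 1 else 0)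
      - U $$ (m, j) * cnj (U $$ (m, (\<pi> \<circ> \<sigma>) j))) \<partial>\<mu>)"
    by (intro Bochner_Integration.integral_cong refl entries) (simp add: space_eq)
  also have "\<dots> = ascension k (Suc m) (\<pi> \<circ> \<sigma>)"
    using k by (intro projection_moment permutes_compose \<sigma> \<pi>) auto
  finally show ?thesis .
qed

theorem theorem3p3:
  fixes k n :: nat and \<mu> \<nu> :: "complex mat measure"
  assumes "k \<ge> 1" and "n \<ge> 1" and "k + 1 \<le> n"
    and "haar_unitary n \<mu>" and "haar_unitary (n - 1) \<nu>"
  shows "\<forall>\<pi>\<in>sym_group k.
    weingarten k \<mu> \<pi> = group_convolution k (ascension k n) (weingarten k \<nu>) \<pi>"
proof
  fix \<pi> assume "\<pi> \<in> sym_group k"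
  then have \<pi>: "\<pi> permutes {..<k}" by (simp add: sym_group_def)
  obtain m where n: "n = Suc m" using assms(2) by (cases n) auto
  then have k: "k \<le> m" using assms(3) by simp
  have \<mu>: "haar_law (Suc m) \<mu>" and \<nu>: "haar_law m \<nu>"
    using assms n by (auto simp: haar_law_def)
  interpret \<nu>: haar_law m \<nu> by (rule \<nu>)
  let ?I = "{..<k}" and ?P = "{\<sigma>. \<sigma> permutes {..<k}}" and ?W = "weingarten k \<nu>"
  let ?L = "?I \<rightarrow>\<^sub>E {..<m}" and ?inv = "inv_into UNIV :: (nat \<Rightarrow> nat) \<Rightarrow> nat \<Rightarrow> nat"
  have finL: "finite ?L" by (intro finite_PiE) auto
  have PI: "\<sigma> i < k" if "\<sigma> permutes ?I" "i < k" for \<sigma> i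
    using permutes_in_image[OF that(1), of i] that(2) by simp
  \<comment> \<open>Split off the block matrix of a Haar-distributed \<open>m \<times> m\<close> matrix.\<close>
  have "weingarten k \<mu> \<pi> =
      (\<Sum>l\<in>?L. \<Sum>l'\<in>?L. moment \<nu> ?I id l id l' * moment \<mu> ?I l id l' \<pi>)"
    unfolding weingarten_moment
  proof (rule moment_restrict[OF \<mu> \<nu>])
    have km: "i < m" "i < Suc m" if "i < k" for i using that k by simp_all
    show "id \<in> ?I \<rightarrow> {..<m}" "id \<in> ?I \<rightarrow> {..<m}" "id \<in> ?I \<rightarrow> {..<Suc m}" "\<pi> \<in> ?I \<rightarrow> {..<Suc m}"
      using km PI[OF \<pi>] by simp_all
  qed simp
  also have "\<dots> = (\<Sum>l\<in>?L. \<Sum>l'\<in>?L. \<Sum>\<sigma>\<in>?P.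
      if \<forall>i<k. l' (\<sigma> i) = l i then ?W (?inv \<sigma>) * moment \<mu> ?I l id l' \<pi> else 0)"
  proof (intro sum.cong refl)
    fix l l' assume l: "l \<in> ?L" "l' \<in> ?L"
    then have ll: "l \<in> ?I \<rightarrow> {..<m}" "l' \<in> ?I \<rightarrow> {..<m}" by (auto simp: PiE_def)
    \<comment> \<open>Passing to the adjoint makes the columns distinct and the rows arbitrary.\<close>
    have "moment \<nu> ?I id l id l' = moment \<nu> ?I l' id l id"
      using ll k by (intro \<nu>.moment_adjoint) auto
    also have "\<dots> = (\<Sum>\<sigma>\<in>?P. if \<forall>i<k. l' (\<sigma> i) = l i then moment \<nu> ?I id id \<sigma> id else 0)"
      by (rule \<nu>.moment_distinct_columns[OF k ll(2,1)])
    also have "\<dots> = (\<Sum>\<sigma>\<in>?P. if \<forall>i<k. l' (\<sigma> i) = l i then ?W (?inv \<sigma>) else 0)"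
    proof (intro sum.cong refl)
      fix \<sigma> assume "\<sigma> \<in> ?P"
      then have "moment \<nu> ?I id id \<sigma> id = ?W (?inv \<sigma>)"
        by (intro weingarten_inverse_moment) simp
      then show "(if \<forall>i<k. l' (\<sigma> i) = l i then moment \<nu> ?I id id \<sigma> id else 0) =
          (if \<forall>i<k. l' (\<sigma> i) = l i then ?W (?inv \<sigma>) else 0)" by (simp only:)
    qed
    finally have *: "moment \<nu> ?I id l id l' =
        (\<Sum>\<sigma>\<in>?P. if \<forall>i<k. l' (\<sigma> i) = l i then ?W (?inv \<sigma>) else 0)" .
    show "moment \<nu> ?I id l id l' * moment \<mu> ?I l id l' \<pi> =
        (\<Sum>\<sigma>\<in>?P. if \<forall>i<k. l' (\<sigma> i) = l i then ?W (?inv \<sigma>) * moment \<mu> ?I l id l' \<pi> else 0)"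
      unfolding * sum_distrib_right by (intro sum.cong refl) auto
  qed
  also have "\<dots> = (\<Sum>\<sigma>\<in>?P. \<Sum>l'\<in>?L. \<Sum>l\<in>?L.
      if \<forall>i<k. l' (\<sigma> i) = l i then ?W (?inv \<sigma>) * moment \<mu> ?I l id l' \<pi> else 0)"
    by (subst sum.swap) (simp only: sum.swap[of _ ?P])
  also have "\<dots> = (\<Sum>\<sigma>\<in>?P. \<Sum>l'\<in>?L. ?W (?inv \<sigma>) * moment \<mu> ?I (l' \<circ> \<sigma>) id l' \<pi>)"
  proof (intro sum.cong refl)
    fix \<sigma> l' assume \<sigma>: "\<sigma> \<in> ?P" and l': "l' \<in> ?L"
    let ?l = "restrict (l' \<circ> \<sigma>) ?I"
    have "?l \<in> ?L"
    proof (rule restrict_PiE_iff[THEN iffD2], rule ballI)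
      fix i assume "i \<in> ?I"
      then show "(l' \<circ> \<sigma>) i \<in> {..<m}" using PiE_mem[OF l', of "\<sigma> i"] PI[of \<sigma> i] \<sigma> by simp
    qed
    have "(\<forall>i<k. l' (\<sigma> i) = l i) \<longleftrightarrow> l = ?l" if "l \<in> ?L" for l
    proof
      assume eq: "\<forall>i<k. l' (\<sigma> i) = l i"
      show "l = ?l"
        by (rule PiE_ext[OF \<open>l \<in> ?L\<close> \<open>?l \<in> ?L\<close>]) (use eq in simp)
    next
      assume "l = ?l"
      then have "l i = ?l i" for i by (rule fun_cong)
      then show "\<forall>i<k. l' (\<sigma> i) = l i" by simp
    qed
    then have "(\<Sum>l\<in>?L. if \<forall>i<k. l' (\<sigma> i) = l i then ?W (?inv \<sigma>) * moment \<mu> ?I l id l' \<pi> else 0) =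
        (\<Sum>l\<in>?L. if l = ?l then ?W (?inv \<sigma>) * moment \<mu> ?I l id l' \<pi> else 0)"
      by (intro sum.cong refl) (simp only:)
    also have "\<dots> = ?W (?inv \<sigma>) * moment \<mu> ?I ?l id l' \<pi>"
      using finL \<open>?l \<in> ?L\<close> by simp
    also have "moment \<mu> ?I ?l id l' \<pi> = moment \<mu> ?I (l' \<circ> \<sigma>) id l' \<pi>"
      by (intro moment_cong) auto
    finally show "(\<Sum>l\<in>?L. if \<forall>i<k. l' (\<sigma> i) = l i then ?W (?inv \<sigma>) * moment \<mu> ?I l id l' \<pi> else 0) =
        ?W (?inv \<sigma>) * moment \<mu> ?I (l' \<circ> \<sigma>) id l' \<pi>" .
  qed
  also have "\<dots> = (\<Sum>\<sigma>\<in>?P. ?W (?inv \<sigma>) * ascension k n (\<pi> \<circ> \<sigma>))"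
    unfolding n sum_distrib_left[symmetric]
    by (intro sum.cong refl arg_cong2[where f = "(*)"] moment_row_sum \<mu> k \<pi>) auto
  also have "\<dots> = (\<Sum>\<sigma>\<in>?P. ascension k n (\<pi> \<circ> \<sigma>) * ?W (?inv (\<pi> \<circ> \<sigma>) \<circ> \<pi>))"
  proof (intro sum.cong refl)
    fix \<sigma> assume "\<sigma> \<in> ?P"
    then have "?inv (\<pi> \<circ> \<sigma>) \<circ> \<pi> = ?inv \<sigma>"
      using \<pi> by (simp add: o_inv_distrib permutes_bij o_assoc[symmetric] permutes_inv_o)
    then show "?W (?inv \<sigma>) * ascension k n (\<pi> \<circ> \<sigma>) =
        ascension k n (\<pi> \<circ> \<sigma>) * ?W (?inv (\<pi> \<circ> \<sigma>) \<circ> \<pi>)" by simp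
  qed
  also have "\<dots> = group_convolution k (ascension k n) ?W \<pi>"
    unfolding group_convolution_def sym_group_def
    by (rule setum_permutations_compose_left[OF \<pi>, symmetric])
  finally show "weingarten k \<mu> \<pi> = group_convolution k (ascension k n) ?W \<pi>" .
qed

end
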